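(* Let $\Omega\subset\mathbb{R}^n$ be an open and bounded domain and $B_{\mathcal{J}}=\{u\in L^2(\Omega):\mathcal{J}(u)\le 1\}$. Then $u\in B_{\mathcal{J}}$ is an extreme point of $B_{\mathcal{J}}$ if and only if for almost all $x\in\Omega$ it holds $$\inf_{z\in\partial\Omega}\varepsilon^u_{x,z}=0.$$
   Context: $W^{1,\infty}_0(\Omega)=\{u\in W^{1,\infty}(\Omega): u=0\text{ on }\partial\Omega\}$ (Lipschitz functions vanishing on $\partial\Omega$, regarded as continuous functions on $\overline\Omega$). $\mathcal{J}:L^2(\Omega)\to[0,\infty]$ is $\mathcal{J}(u)=\|\nabla u\|_\infty$ if $u\in W^{1,\infty}_0(\Omega)$ and $+\infty$ otherwise. Extreme points of a convex set $C$ are the $u\in C$ for which there are no $v\neq w\in C$ and $\lambda\in(0,1)$ with $u=\lambda v+(1-\lambda)w$. For $u\in B_{\mathcal{J}}$, $x\in\Omega$ and $z\in\partial\Omega$, the number $\varepsilon^u_{x,z}$ is the infimum of all $\varepsilon>0$ for which there exist a finite number $m$ of steps, points $x_0=z,x_1,\dots,x_m=x$ in $\overline\Omega$ and non-negative numbers $\varepsilon_1,\dots,\varepsilon_m$ with $\sum_{i=1}^m\varepsilon_i\le\varepsilon$ such that $|x_{i-1}-x_i|-\varepsilon_i\le|u(x_{i-1})-u(x_i)|$ for all $i=1,\dots,m$. *)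

theory Defs
  imports "HOL-Probability.Essential_Supremum"
begin

text \<open>
  Elements of \<open>L\<^sup>2(\<Omega>)\<close>, \<open>L\<^sup>\<infinity>(\<Omega>)\<close> and \<open>W\<^sup>1\<^sup>,\<^sup>\<infinity>(\<Omega>)\<close> are represented by functions on the whole
  space, of which only the restriction to \<open>\<Omega>\<close> matters. Two such functions are the same
  element iff they agree almost everywhere on \<open>\<Omega>\<close>.
\<close>

definition ae_eq :: "'a::euclidean_space set \<Rightarrow> ('a \<Rightarrow> real) \<Rightarrow> ('a \<Rightarrow> real) \<Rightarrow> bool" where
  "ae_eq \<Omega> f g \<longleftrightarrow> (AE x in lebesgue_on \<Omega>. f x = g x)"

definition L2 :: "'a::euclidean_space set \<Rightarrow> ('a \<Rightarrow> real) set" where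
  "L2 \<Omega> = {u \<in> borel_measurable (lebesgue_on \<Omega>). integrable (lebesgue_on \<Omega>) (\<lambda>x. (u x)\<^sup>2)}"

definition Linf_norm :: "'a::euclidean_space set \<Rightarrow> ('a \<Rightarrow> 'b::real_normed_vector) \<Rightarrow> ennreal" where
  "Linf_norm \<Omega> f = esssup (lebesgue_on \<Omega>) (\<lambda>x. ennreal (norm (f x)))"

definition Linf :: "'a::euclidean_space set \<Rightarrow> ('a \<Rightarrow> 'b::real_normed_vector) set" where
  "Linf \<Omega> = {f \<in> borel_measurable (lebesgue_on \<Omega>). Linf_norm \<Omega> f < \<infinity>}"

primrec Ck :: "nat \<Rightarrow> ('a::euclidean_space \<Rightarrow> real) \<Rightarrow> bool" where
  "Ck 0 f \<longleftrightarrow> continuous_on UNIV f"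
| "Ck (Suc k) f \<longleftrightarrow> (\<forall>x. f differentiable (at x)) \<and>
     (\<forall>i\<in>Basis. Ck k (\<lambda>x. frechet_derivative f (at x) i))"

text \<open>The space \<open>C\<^sub>c\<^sup>\<infinity>(\<Omega>)\<close>; its elements are extended by zero to the whole space.\<close>

definition test_functions :: "'a::euclidean_space set \<Rightarrow> ('a \<Rightarrow> real) set" where
  "test_functions \<Omega> = {\<phi>. (\<forall>k. Ck k \<phi>) \<and> compact (closure {x. \<phi> x \<noteq> 0}) \<and>
     closure {x. \<phi> x \<noteq> 0} \<subseteq> \<Omega>}"

definition is_weak_gradient ::
  "'a::euclidean_space set \<Rightarrow> ('a \<Rightarrow> real) \<Rightarrow> ('a \<Rightarrow> 'a) \<Rightarrow> bool" where
  "is_weak_gradient \<Omega> u G \<longleftrightarrow>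
     (\<forall>K. compact K \<and> K \<subseteq> \<Omega> \<longrightarrow> u absolutely_integrable_on K \<and> G absolutely_integrable_on K) \<and>
     (\<forall>\<phi>\<in>test_functions \<Omega>. \<forall>i\<in>Basis.
        (LINT x|lebesgue_on \<Omega>. u x * frechet_derivative \<phi> (at x) i) =
        - (LINT x|lebesgue_on \<Omega>. (G x \<bullet> i) * \<phi> x))"

text \<open>The weak gradient is unique up to null sets, so the choice is immaterial.\<close>

definition weak_gradient :: "'a::euclidean_space set \<Rightarrow> ('a \<Rightarrow> real) \<Rightarrow> 'a \<Rightarrow> 'a" where
  "weak_gradient \<Omega> u = (SOME G. is_weak_gradient \<Omega> u G)"

definition W1inf :: "'a::euclidean_space set \<Rightarrow> ('a \<Rightarrow> real) set" where
  "W1inf \<Omega> = {u \<in> Linf \<Omega>. \<exists>G \<in> Linf \<Omega>. is_weak_gradient \<Omega> u G}"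

definition is_cont_rep ::
  "'a::euclidean_space set \<Rightarrow> ('a \<Rightarrow> real) \<Rightarrow> ('a \<Rightarrow> real) \<Rightarrow> bool" where
  "is_cont_rep \<Omega> u U \<longleftrightarrow> continuous_on (closure \<Omega>) U \<and> ae_eq \<Omega> U u"

text \<open>For open \<open>\<Omega>\<close>, the values of a continuous representative on \<open>closure \<Omega>\<close> are unique.\<close>

definition cont_rep :: "'a::euclidean_space set \<Rightarrow> ('a \<Rightarrow> real) \<Rightarrow> 'a \<Rightarrow> real" where
  "cont_rep \<Omega> u = (SOME U. is_cont_rep \<Omega> u U)"

definition W1inf_0 :: "'a::euclidean_space set \<Rightarrow> ('a \<Rightarrow> real) set" where
  "W1inf_0 \<Omega> = {u \<in> W1inf \<Omega>. \<exists>U. is_cont_rep \<Omega> u U \<and> (\<forall>x\<in>frontier \<Omega>. U x = 0)}"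

definition J :: "'a::euclidean_space set \<Rightarrow> ('a \<Rightarrow> real) \<Rightarrow> ennreal" where
  "J \<Omega> u = (if u \<in> W1inf_0 \<Omega> then Linf_norm \<Omega> (weak_gradient \<Omega> u) else \<infinity>)"

definition B_J :: "'a::euclidean_space set \<Rightarrow> ('a \<Rightarrow> real) set" where
  "B_J \<Omega> = {u \<in> L2 \<Omega>. J \<Omega> u \<le> 1}"

text \<open>
  Extreme points of a convex set \<open>C\<close> of elements of \<open>L\<^sup>2(\<Omega>)\<close>. The constant
  \<^const>\<open>extreme_point_of\<close> is not applicable, because it would compare representatives
  pointwise instead of almost everywhere.
\<close>

definition extreme_point_ae ::
  "'a::euclidean_space set \<Rightarrow> ('a \<Rightarrow> real) set \<Rightarrow> ('a \<Rightarrow> real) \<Rightarrow> bool" where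
  "extreme_point_ae \<Omega> C u \<longleftrightarrow> u \<in> C \<and>
     \<not> (\<exists>v\<in>C. \<exists>w\<in>C. \<exists>l::real. \<not> ae_eq \<Omega> v w \<and> 0 < l \<and> l < 1 \<and>
          ae_eq \<Omega> u (\<lambda>x. l * v x + (1 - l) * w x))"

text \<open>
  The number \<open>\<epsilon>\<^sup>u\<^sub>x\<^sub>,\<^sub>z\<close>, depending on the values of \<open>u\<close> at points of \<open>closure \<Omega>\<close>. The set below
  is nonempty for \<open>x, z \<in> closure \<Omega>\<close>: one step with \<open>e 1 = norm (z - x)\<close> is always admissible.
\<close>

definition eps :: "'a::euclidean_space set \<Rightarrow> ('a \<Rightarrow> real) \<Rightarrow> 'a \<Rightarrow> 'a \<Rightarrow> real" where
  "eps \<Omega> u x z = Inf {\<epsilon>. 0 < \<epsilon> \<and>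
     (\<exists>(m::nat) (p::nat \<Rightarrow> 'a) (e::nat \<Rightarrow> real).
        p 0 = z \<and> p m = x \<and> (\<forall>i\<le>m. p i \<in> closure \<Omega>) \<and>
        (\<forall>i\<in>{1..m}. 0 \<le> e i) \<and> (\<Sum>i=1..m. e i) \<le> \<epsilon> \<and>
        (\<forall>i\<in>{1..m}. norm (p (i - 1) - p i) - e i \<le> \<bar>u (p (i - 1)) - u (p i)\<bar>))}"

end

theory Submission
  imports Defs "HOL-Computational_Algebra.Polynomial"
begin

text \<open>
  The elements of the unit ball are exactly the functions whose zero extension to the whole space
  is 1-Lipschitz. The infimum \<open>g x\<close> of \<open>\<epsilon>\<^sup>u\<^sub>x\<^sub>,\<^sub>z\<close> over the boundary points \<open>z\<close> vanishes on the boundary.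
  Prolonging a chain by one step gives \<open>\<bar>g x - g y\<bar> \<le> \<bar>x - y\<bar> - \<bar>u x - u y\<bar>\<close>, so \<open>u + g\<close> and \<open>u - g\<close> are
  again in the unit ball, and \<open>u\<close> is their midpoint: an extreme point has \<open>g = 0\<close>. Conversely, if
  \<open>u = l v + (1 - l) w\<close>, then along a step of a chain with defect \<open>e\<close> the difference \<open>v - w\<close> changes by
  at most \<open>e / min l (1 - l)\<close>. It vanishes on the boundary, hence wherever \<open>g\<close> does.

  That the unit ball consists of 1-Lipschitz functions is shown by mollification. For the other
  inclusion, a weak gradient of a Lipschitz function is obtained as an \<open>L\<^sup>2\<close> limit of convex
  combinations of difference quotients, and any weak gradient is bounded by 1 because its
  integral against nonnegative test functions is a limit of such integrals of difference quotients.
\<close>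

subsection \<open>Smooth functions\<close>

text \<open>Omega may be far from convex, so a gradient bound by itself controls u only along
  segments inside Omega. The zero boundary values repair this: a segment that leaves Omega passes
  through a zero of the extension, and the distances of its two ends to that zero add up to its
  length. This is why the argument is phrased with the extension by zero, which also lets translates
  be integrated without boundary terms.

  The weak gradient in \<open>J\<close> is picked by choice, so the bound by 1 is proved for every
  weak gradient. Existence is a separate matter, for which a crude bound by the dimension suffices.
  In both, the convergence of integrals of difference quotients is read off the smooth test
  function, after a translation has moved the quotient onto it.

  Chains run through arbitrary points of the closure, null sets and boundary included. An identity
  that holds almost everywhere must therefore first be upgraded, through continuous representatives,
  to one that holds everywhere on the closure.\<close>

lemma Ck_SucI:
  assumes "\<And>x. (f has_derivative f' x) (at x)"
    and "\<And>i. i \<in> Basis \<Longrightarrow> Ck k (\<lambda>x. f' x i)"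
  shows "Ck (Suc k) f"
proof -
  have "frechet_derivative f (at x) = f' x" for x
    using frechet_derivative_at[OF assms(1)] by simp
  then show ?thesis
    using assms by (auto simp: differentiable_def)
qed

lemma Ck_Suc_has_derivative:
  assumes "Ck (Suc k) f"
  shows "(f has_derivative frechet_derivative f (at x)) (at x)"
  using assms by (simp add: frechet_derivative_works)

lemma Ck_SucD: "Ck (Suc k) f \<Longrightarrow> Ck k f"
proof (induction k arbitrary: f)
  case 0
  then show ?case
    by (auto intro!: differentiable_imp_continuous_on simp: differentiable_on_def)
next
  case (Suc k)
  then show ?case by auto
qed

lemma Ck_continuous: "Ck k f \<Longrightarrow> continuous_on A f"
proof (induction k)
  case 0
  then show ?case using continuous_on_subset[of UNIV f A] by simp
next
  case (Suc k)
  then show ?case using Ck_SucD by blast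
qed

lemma Ck_const [simp]: "Ck k (\<lambda>x. c)"
  by (induction k arbitrary: c) (auto intro: Ck_SucI)

lemma Ck_add:
  "Ck k f \<Longrightarrow> Ck k g \<Longrightarrow> Ck k (\<lambda>x. f x + g x)"
proof (induction k arbitrary: f g)
  case 0
  then show ?case by (auto intro: continuous_intros)
next
  case (Suc k)
  show ?case
    by (rule Ck_SucI[OF has_derivative_add[OF Ck_Suc_has_derivative[OF Suc.prems(1)]
          Ck_Suc_has_derivative[OF Suc.prems(2)]]])
       (use Suc in auto)
qed

lemma Ck_mult:
  "Ck k f \<Longrightarrow> Ck k g \<Longrightarrow> Ck k (\<lambda>x. f x * g x)"
proof (induction k arbitrary: f g)
  case 0
  then show ?case by (auto intro: continuous_intros)
next
  case (Suc k)
  show ?case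
    by (rule Ck_SucI[OF has_derivative_mult[OF Ck_Suc_has_derivative[OF Suc.prems(1)]
          Ck_Suc_has_derivative[OF Suc.prems(2)]]])
       (use Suc Ck_SucD[OF Suc.prems(1)] Ck_SucD[OF Suc.prems(2)] in \<open>auto intro!: Ck_add\<close>)
qed

lemma Ck_sum: "(\<And>a. a \<in> A \<Longrightarrow> Ck k (f a)) \<Longrightarrow> Ck k (\<lambda>x. \<Sum>a\<in>A. f a x)"
  by (induction A rule: infinite_finite_induct) (auto intro: Ck_add)

text \<open>Repeated differentiation of \<open>g (f x)\<close> produces ever new outer functions. A
  family \<open>D\<close> closed under differentiation contains all of them, so the induction on k
  can stay inside \<open>D\<close>.\<close>

lemma Ck_compose:
  assumes D: "\<And>g. g \<in> D \<Longrightarrow> \<exists>g'\<in>D. \<forall>t. (g has_real_derivative g' t) (at t)"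
  shows "g \<in> D \<Longrightarrow> Ck k f \<Longrightarrow> Ck k (\<lambda>x. g (f x))"
proof (induction k arbitrary: g)
  case 0
  then have "continuous_on UNIV g"
    using D by (meson DERIV_continuous_on has_field_derivative_at_within)
  with 0 show ?case
    by (auto intro: continuous_on_compose2)
next
  case (Suc k)
  from D[OF Suc.prems(1)] obtain g' where g': "g' \<in> D"
    "\<And>t. (g has_real_derivative g' t) (at t)" by blast
  have "((\<lambda>x. g (f x)) has_derivative (\<lambda>h. g' (f x) * frechet_derivative f (at x) h)) (at x)" for x
    using has_derivative_compose[OF Ck_Suc_has_derivative[OF Suc.prems(2)]
        g'(2)[unfolded has_field_derivative_def]] by simp
  then show ?case
    by (rule Ck_SucI) (use Suc g' Ck_SucD[OF Suc.prems(2)] in \<open>auto intro!: Ck_mult\<close>)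
qed

section \<open>A function flat at the origin and the bumps built from it\<close>

definition flat :: "real poly \<Rightarrow> real \<Rightarrow> real" where
  "flat p t = (if 0 < t then poly p (1 / t) * exp (- (1 / t)) else 0)"

lemma poly_exp_decay: "((\<lambda>x. poly p x * exp (- x)) \<longlongrightarrow> (0::real)) at_top"
proof -
  have "((\<lambda>x. \<Sum>i\<le>degree p. coeff p i * (x ^ i / exp x)) \<longlongrightarrow> (\<Sum>i\<le>degree p. coeff p i * 0)) at_top"
    by (intro tendsto_intros tendsto_power_div_exp_0)
  moreover have "(\<lambda>x. \<Sum>i\<le>degree p. coeff p i * (x ^ i / exp x)) = (\<lambda>x. poly p x * exp (- x))"
    by (auto simp: poly_altdef sum_distrib_right exp_minus divide_simps)
  ultimately show ?thesis by simp
qed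

text \<open>With s = 1/t, the derivative of p(s) exp(-s) in t is s^2 (p - p')(s) exp(-s), which has
  the same form again. The polynomial parameter of \<open>flat\<close> exists to make the family
  closed under differentiation, as \<open>Ck_compose\<close> demands.\<close>

lemma flat_has_derivative:
  "(flat p has_real_derivative flat ([:0, 0, 1:] * (p - pderiv p)) t) (at t)"
proof -
  consider "t > 0" | "t < 0" | "t = 0" by linarith
  then show ?thesis
  proof cases
    case 1
    have "((\<lambda>t. poly p (1 / t) * exp (- (1 / t))) has_real_derivative
        flat ([:0, 0, 1:] * (p - pderiv p)) t) (at t)"
    proof -
      have inv: "((\<lambda>t. 1 / t) has_real_derivative - (1 / t\<^sup>2)) (at t)"
        using 1 by (auto intro!: derivative_eq_intros simp: power2_eq_square)
      show ?thesis
        using DERIV_mult[OF DERIV_chain2[OF poly_DERIV[of p] inv]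
            DERIV_chain2[OF DERIV_exp DERIV_minus[OF inv]]] 1
        by (simp add: flat_def field_simps power2_eq_square)
    qed
    then show ?thesis
      by (rule has_field_derivative_transform_within_open[where S = "{0<..}"])
         (use 1 in \<open>auto simp: flat_def\<close>)
  next
    case 2
    have "((\<lambda>t. 0) has_real_derivative flat ([:0, 0, 1:] * (p - pderiv p)) t) (at t)"
      using 2 by (auto simp: flat_def)
    then show ?thesis
      by (rule has_field_derivative_transform_within_open[where S = "{..<0}"])
         (use 2 in \<open>auto simp: flat_def\<close>)
  next
    case 3
    \<comment> \<open>The quotient \<open>flat p h / h\<close> carries one more factor 1/h, so the
      polynomial is multiplied by X before the exponential decay is applied.\<close>
    have "((\<lambda>h. poly ([:0, 1:] * p) (inverse h) * exp (- inverse h)) \<longlongrightarrow> 0) (at_right 0)"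
      using poly_exp_decay filterlim_inverse_at_top_right by (rule filterlim_compose)
    then have "((\<lambda>h. flat p h / h) \<longlongrightarrow> 0) (at_right 0)"
      by (rule Lim_transform_eventually)
         (auto simp: flat_def eventually_at_filter field_simps)
    moreover have "((\<lambda>h. flat p h / h) \<longlongrightarrow> 0) (at_left 0)"
      by (rule tendsto_eventually) (auto simp: flat_def eventually_at_filter)
    ultimately have "((\<lambda>h. flat p h / h) \<longlongrightarrow> 0) (at 0)"
      by (simp add: filterlim_split_at)
    then show ?thesis
      using 3 by (simp add: DERIV_def flat_def)
  qed
qed

lemma Ck_flat: "Ck k f \<Longrightarrow> Ck k (\<lambda>x. flat p (f x))"
  by (rule Ck_compose[where D = "range flat"]) (auto intro: flat_has_derivative)

lemma Ck_exp:
  assumes "Ck k f"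
  shows "Ck k (\<lambda>x. exp (f x))"
  by (rule Ck_compose[where D = "{exp}"]) (use assms in \<open>auto intro: DERIV_exp\<close>)

lemma Ck_inner: "Ck k (\<lambda>x. (x - a) \<bullet> b)"
proof (cases k)
  case (Suc l)
  have "((\<lambda>x. (x - a) \<bullet> b) has_derivative (\<lambda>h. h \<bullet> b)) (at x)" for x
    by (auto intro!: derivative_eq_intros)
  then show ?thesis
    unfolding Suc by (rule Ck_SucI) simp
qed (auto intro!: continuous_intros)

lemma Ck_norm_square: "Ck k (\<lambda>x. (norm (x - a))\<^sup>2)"
proof -
  have "Ck k (\<lambda>x. \<Sum>b\<in>Basis. ((x - a) \<bullet> b) * ((x - a) \<bullet> b))"
    by (intro Ck_sum Ck_mult Ck_inner)
  then show ?thesis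
    by (simp add: power2_norm_eq_inner euclidean_inner[symmetric])
qed

text \<open>The squared distance is a polynomial in the coordinates, which keeps the bump smooth at
  its centre as well.\<close>

definition bump :: "real \<Rightarrow> 'a::euclidean_space \<Rightarrow> 'a \<Rightarrow> real" where
  "bump r a x = flat 1 (r\<^sup>2 - (norm (x - a))\<^sup>2)"

lemma Ck_bump: "Ck k (bump r a)"
proof -
  have "Ck k (\<lambda>x. flat 1 (r\<^sup>2 + (-1) * (norm (x - a))\<^sup>2))"
    by (intro Ck_flat Ck_add Ck_mult Ck_const Ck_norm_square)
  then show ?thesis by (simp add: bump_def[abs_def])
qed

lemma bump_nonneg: "0 \<le> bump r a x"
  by (simp add: bump_def flat_def)

lemma bump_pos_iff:
  assumes "0 < r"
  shows "0 < bump r a x \<longleftrightarrow> norm (x - a) < r"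
proof -
  have "0 < bump r a x \<longleftrightarrow> (norm (x - a))\<^sup>2 < r\<^sup>2"
    by (simp add: bump_def flat_def)
  also have "\<dots> \<longleftrightarrow> norm (x - a) < r"
    using assms power2_less_imp_less[of "norm (x - a)" r]
      power_strict_mono[of "norm (x - a)" r 2] by fastforce
  finally show ?thesis .
qed

lemma bump_eq_0: "0 < r \<Longrightarrow> r \<le> norm (x - a) \<Longrightarrow> bump r a x = 0"
  using bump_pos_iff[of r a x] bump_nonneg[of r a x] by auto

lemma bump_translate: "bump r (a + h) x = bump r a (x - h)"
  by (simp add: bump_def algebra_simps)

lemma test_functionsI:
  fixes \<phi> :: "'a::euclidean_space \<Rightarrow> real"
  assumes "\<And>k. Ck k \<phi>" "compact K" "K \<subseteq> \<Omega>" "\<And>x. \<phi> x \<noteq> 0 \<Longrightarrow> x \<in> K"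
  shows "\<phi> \<in> test_functions \<Omega>"
proof -
  have "closure {x. \<phi> x \<noteq> 0} \<subseteq> K"
    using assms by (intro closure_minimal) (auto simp: compact_imp_closed)
  then show ?thesis
    using assms(1,3) compact_Int_closed[OF assms(2), of "closure {x. \<phi> x \<noteq> 0}"]
    by (simp add: test_functions_def Int_absorb1)
qed

lemma bump_test_function:
  assumes "0 < r" "cball a r \<subseteq> \<Omega>"
  shows "bump r a \<in> test_functions \<Omega>"
proof (rule test_functionsI[OF Ck_bump _ assms(2)])
  show "x \<in> cball a r" if "bump r a x \<noteq> 0" for x
    using bump_eq_0[OF assms(1), of x a] that by (cases "r \<le> norm (x - a)") (auto simp: dist_norm norm_minus_commute)
qed simp

lemma test_function_support:
  assumes "\<phi> \<in> test_functions \<Omega>"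
  obtains K where "compact K" "K \<subseteq> \<Omega>" "\<And>x. x \<notin> K \<Longrightarrow> \<phi> x = 0"
    "\<And>x h. x \<notin> K \<Longrightarrow> frechet_derivative \<phi> (at x) h = 0"
proof
  let ?K = "closure {x. \<phi> x \<noteq> 0}"
  show "compact ?K" "?K \<subseteq> \<Omega>" using assms by (auto simp: test_functions_def)
  show "\<phi> x = 0" if "x \<notin> ?K" for x using that closure_subset[of "{x. \<phi> x \<noteq> 0}"] by blast
  show "frechet_derivative \<phi> (at x) h = 0" if "x \<notin> ?K" for x h
  proof -
    have "(\<phi> has_derivative (\<lambda>h. 0)) (at x)"
    proof (rule has_derivative_transform_within_open[of "\<lambda>x. 0" _ x UNIV "- ?K"])
      show "0 = \<phi> y" if "y \<in> - ?K" for y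
        using that closure_subset[of "{x. \<phi> x \<noteq> 0}"] by force
    qed (use that in auto)
    then show ?thesis using frechet_derivative_at by metis
  qed
qed

text \<open>A finite sum S of bumps over a cover of K is positive on K, hence bounded below there.
  Then 1 - exp (- n S) is smooth, stays in [0, 1], vanishes where S does, and approaches 1 uniformly
  on K as n grows. The single parameter r measures both the width of the neighbourhood and the error
  on K.\<close>

lemma approximate_indicator_compact:
  fixes K :: "'a::euclidean_space set"
  assumes "compact K" "K \<noteq> {}" "0 < r" "{x. infdist x K \<le> r} \<subseteq> \<Omega>"
  obtains \<phi> where "\<phi> \<in> test_functions \<Omega>" "\<And>x. 0 \<le> \<phi> x" "\<And>x. \<phi> x \<le> 1"
    "\<And>x. x \<in> K \<Longrightarrow> 1 - r \<le> \<phi> x" "\<And>x. r \<le> infdist x K \<Longrightarrow> \<phi> x = 0"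
proof -
  obtain F where F: "finite F" "F \<subseteq> K" "K \<subseteq> (\<Union>a\<in>F. ball a r)"
    using compactE_image[OF assms(1), of K "\<lambda>a. ball a r"] assms(3)
    by (metis UN_I centre_in_ball open_ball subsetI)
  define S where "S x = (\<Sum>a\<in>F. bump r a x)" for x
  have Ck_S: "Ck k S" for k unfolding S_def[abs_def] by (intro Ck_sum Ck_bump)
  have S_nonneg: "0 \<le> S x" for x unfolding S_def by (intro sum_nonneg bump_nonneg)
  have S_pos: "0 < S x" if "x \<in> K" for x
  proof -
    obtain a where "a \<in> F" "x \<in> ball a r" using F(3) \<open>x \<in> K\<close> by blast
    then show ?thesis
      unfolding S_def using F(1) assms(3)
      by (intro sum_pos2[of _ a]) (auto simp: bump_pos_iff bump_nonneg dist_norm norm_minus_commute)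
  qed
  have S_0: "S x = 0" if "r \<le> infdist x K" for x
    unfolding S_def
  proof (intro sum.neutral ballI bump_eq_0 assms(3))
    fix a assume "a \<in> F"
    then show "r \<le> norm (x - a)"
      using infdist_le[of a K x] F that by (auto simp: dist_norm)
  qed
  obtain x0 where x0: "x0 \<in> K" "\<And>x. x \<in> K \<Longrightarrow> S x0 \<le> S x"
    using continuous_attains_inf[OF assms(1,2) Ck_continuous[OF Ck_S[of 0]]] by auto
  \<comment> \<open>This n makes exp (- n S x0) < r, where S x0 is the minimum of S on K.\<close>
  obtain n :: nat where n: "- ln r < real n * S x0"
    using reals_Archimedean3[OF S_pos[OF x0(1)]] by blast
  define \<phi> where "\<phi> x = 1 + (-1) * exp ((- real n) * S x)" for x
  show thesis
  proof
    have "Ck k \<phi>" for k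
      unfolding \<phi>_def[abs_def] by (intro Ck_add Ck_mult Ck_exp Ck_const Ck_S)
    moreover have "compact {x. infdist x K \<le> r}"
      using compact_infdist_le[OF assms(2,1)] assms(3) by simp
    ultimately show "\<phi> \<in> test_functions \<Omega>"
    proof (rule test_functionsI[OF _ _ assms(4)])
      show "x \<in> {x. infdist x K \<le> r}" if "\<phi> x \<noteq> 0" for x
        using that S_0[of x] by (cases "r \<le> infdist x K") (auto simp: \<phi>_def)
    qed
    show "0 \<le> \<phi> x" "\<phi> x \<le> 1" for x
      using S_nonneg[of x] by (auto simp: \<phi>_def)
    show "\<phi> x = 0" if "r \<le> infdist x K" for x
      using S_0[OF that] by (simp add: \<phi>_def)
    show "1 - r \<le> \<phi> x" if "x \<in> K" for x
    proof -
      have "real n * S x0 \<le> real n * S x" using x0(2)[OF that] by (simp add: mult_left_mono)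
      then have "exp (- real n * S x) \<le> exp (ln r)" using n by simp
      then show ?thesis using assms(3) by (simp add: \<phi>_def)
    qed
  qed
qed

subsection \<open>Integrals against test functions\<close>

lemma Ck_borel_measurable: "Ck k f \<Longrightarrow> f \<in> borel_measurable borel"
  by (rule borel_measurable_continuous_onI) (rule Ck_continuous)

lemma borel_measurable_lebesgue_on:
  "f \<in> borel_measurable borel \<Longrightarrow> f \<in> borel_measurable (lebesgue_on S)"
  by (intro measurable_restrict_space1 measurable_completion) simp

lemma test_function_Ck: "\<phi> \<in> test_functions \<Omega> \<Longrightarrow> Ck k \<phi>"
  by (simp add: test_functions_def)

lemma test_function_has_derivative:
  "\<phi> \<in> test_functions \<Omega> \<Longrightarrow> (\<phi> has_derivative frechet_derivative \<phi> (at x)) (at x)"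
  using Ck_Suc_has_derivative test_function_Ck by blast

lemma compactly_supported_bounded:
  fixes f :: "'a::euclidean_space \<Rightarrow> real"
  assumes "continuous_on UNIV f" "compact K" "\<And>x. x \<notin> K \<Longrightarrow> f x = 0"
  obtains B where "0 \<le> B" "\<And>x. \<bar>f x\<bar> \<le> B"
proof -
  have "compact (f ` K)"
    using assms(1,2) continuous_on_subset by (intro compact_continuous_image) auto
  then obtain B where "\<And>x. x \<in> K \<Longrightarrow> \<bar>f x\<bar> \<le> B"
    using compact_imp_bounded bounded_iff by (metis imageI real_norm_def)
  then have "\<bar>f x\<bar> \<le> \<bar>B\<bar>" for x
    using assms(3)[of x] by (cases "x \<in> K") force+
  with that[of "\<bar>B\<bar>"] show ?thesis by simp
qed

lemma test_function_bounded:
  assumes "\<phi> \<in> test_functions \<Omega>"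
  obtains B where "0 \<le> B" "\<And>x. \<bar>\<phi> x\<bar> \<le> B"
proof -
  obtain K where "compact K" "\<And>x. x \<notin> K \<Longrightarrow> \<phi> x = 0"
    using test_function_support[OF assms] by metis
  with Ck_continuous[OF test_function_Ck[OF assms, of 0]] show ?thesis
    using compactly_supported_bounded that by metis
qed

lemma frechet_derivative_Basis:
  assumes "(\<phi> has_derivative frechet_derivative \<phi> (at x)) (at x)"
  shows "frechet_derivative \<phi> (at x) h = (\<Sum>i\<in>Basis. (h \<bullet> i) * frechet_derivative \<phi> (at x) i)"
proof -
  have lin: "linear (frechet_derivative \<phi> (at x))"
    using assms by (rule has_derivative_linear)
  have "frechet_derivative \<phi> (at x) h = frechet_derivative \<phi> (at x) (\<Sum>i\<in>Basis. (h \<bullet> i) *\<^sub>R i)"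
    by (simp add: euclidean_representation)
  also have "\<dots> = (\<Sum>i\<in>Basis. (h \<bullet> i) * frechet_derivative \<phi> (at x) i)"
    by (simp add: linear_sum[OF lin] linear_scale[OF lin])
  finally show ?thesis .
qed

lemma test_function_derivative_bounded:
  fixes \<phi> :: "'a::euclidean_space \<Rightarrow> real"
  assumes "\<phi> \<in> test_functions \<Omega>"
  obtains B where "0 \<le> B" "\<And>x h. \<bar>frechet_derivative \<phi> (at x) h\<bar> \<le> B * norm h"
proof -
  obtain K where K: "compact K" "\<And>x h. x \<notin> K \<Longrightarrow> frechet_derivative \<phi> (at x) h = 0"
    using test_function_support[OF assms] by metis
  have "\<exists>B\<ge>0. \<forall>x. \<bar>frechet_derivative \<phi> (at x) i\<bar> \<le> B" if "i \<in> Basis" for i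
  proof -
    have "continuous_on UNIV (\<lambda>x. frechet_derivative \<phi> (at x) i)"
      using test_function_Ck[OF assms, of "Suc 0"] that by simp
    from compactly_supported_bounded[OF this K(1) K(2)] show ?thesis by metis
  qed
  then obtain B where B: "\<And>i. i \<in> Basis \<Longrightarrow> 0 \<le> B i"
    "\<And>i x. i \<in> Basis \<Longrightarrow> \<bar>frechet_derivative \<phi> (at x) i\<bar> \<le> B i"
    by metis
  show ?thesis
  proof
    show "0 \<le> (\<Sum>i\<in>Basis. B i)" by (intro sum_nonneg B)
    show "\<bar>frechet_derivative \<phi> (at x) h\<bar> \<le> (\<Sum>i\<in>Basis. B i) * norm h" for x h
    proof -
      have "\<bar>frechet_derivative \<phi> (at x) h\<bar>
          \<le> (\<Sum>i\<in>Basis. \<bar>(h \<bullet> i) * frechet_derivative \<phi> (at x) i\<bar>)"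
        by (subst frechet_derivative_Basis[OF test_function_has_derivative[OF assms]]) (rule sum_abs)
      also have "\<dots> \<le> (\<Sum>i\<in>Basis. norm h * B i)"
        by (intro sum_mono) (auto simp: abs_mult Basis_le_norm intro!: mult_mono B)
      finally show ?thesis by (simp add: sum_distrib_left mult.commute)
    qed
  qed
qed

lemma test_function_lipschitz:
  fixes \<phi> :: "'a::euclidean_space \<Rightarrow> real"
  assumes "\<phi> \<in> test_functions \<Omega>"
  obtains B where "0 \<le> B" "\<And>x y. \<bar>\<phi> x - \<phi> y\<bar> \<le> B * norm (x - y)"
proof -
  obtain B where B: "0 \<le> B" "\<And>x h. \<bar>frechet_derivative \<phi> (at x) h\<bar> \<le> B * norm h"
    using test_function_derivative_bounded[OF assms] by metis
  have "norm (\<phi> x - \<phi> y) \<le> B * norm (x - y)" for x y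
    by (rule differentiable_bound[where S = UNIV and f' = "\<lambda>x. frechet_derivative \<phi> (at x)"])
       (auto intro!: test_function_has_derivative[OF assms] onorm_le B(2))
  with B(1) that show ?thesis by simp
qed

lemma difference_quotient_tendsto:
  assumes "(\<phi> has_derivative D) (at x)" "filterlim t (at 0) F"
  shows "((\<lambda>n. (\<phi> (x + t n *\<^sub>R h) - \<phi> x) / t n) \<longlongrightarrow> (D h :: real)) F"
proof -
  have "((\<lambda>s. x + s *\<^sub>R h) has_derivative (\<lambda>s. s *\<^sub>R h)) (at 0)"
    by (auto intro!: derivative_eq_intros)
  then have "((\<lambda>s. \<phi> (x + s *\<^sub>R h)) has_derivative (\<lambda>s. D (s *\<^sub>R h))) (at 0)"
    by (rule has_derivative_compose[where g = \<phi>]) (simp add: assms(1))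
  moreover have "(\<lambda>s. D (s *\<^sub>R h)) = (*) (D h)"
    using linear_scale[OF has_derivative_linear[OF assms(1)]] by (auto simp: mult.commute)
  ultimately have "((\<lambda>s. \<phi> (x + s *\<^sub>R h)) has_real_derivative D h) (at 0)"
    by (simp add: has_field_derivative_def)
  then have "((\<lambda>s. (\<phi> (x + s *\<^sub>R h) - \<phi> x) / s) \<longlongrightarrow> D h) (at 0)"
    by (simp add: DERIV_def)
  from filterlim_compose[OF this assms(2)] show ?thesis .
qed

text \<open>The Lipschitz constant of the test function bounds all its quotients at once, so a
  constant dominates, and constants are integrable for a finite measure.\<close>

lemma integral_difference_quotient_tendsto:
  fixes \<phi> :: "'a::euclidean_space \<Rightarrow> real"
  assumes \<phi>: "\<phi> \<in> test_functions \<Omega>'"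
    and "finite_measure (lebesgue_on \<Omega>)"
    and U: "U \<in> borel_measurable (lebesgue_on \<Omega>)" "\<And>x. \<bar>U x\<bar> \<le> C"
    and t: "filterlim t (at 0) sequentially"
  shows "(\<lambda>n. LINT x|lebesgue_on \<Omega>. U x * ((\<phi> (x + t n *\<^sub>R h) - \<phi> x) / t n))
    \<longlonglongrightarrow> (LINT x|lebesgue_on \<Omega>. U x * frechet_derivative \<phi> (at x) h)"
proof -
  interpret finite_measure "lebesgue_on \<Omega>" by fact
  obtain B where B: "0 \<le> B" "\<And>x y. \<bar>\<phi> x - \<phi> y\<bar> \<le> B * norm (x - y)"
    using test_function_lipschitz[OF \<phi>] by metis
  have C: "0 \<le> C" using U(2)[of undefined] by linarith
  note lim = difference_quotient_tendsto[OF test_function_has_derivative[OF \<phi>] t]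
  have [measurable]: "\<phi> \<in> borel_measurable borel"
    by (rule Ck_borel_measurable[OF test_function_Ck[OF \<phi>, of 0]])
  have meas: "(\<lambda>x. U x * ((\<phi> (x + s *\<^sub>R h) - \<phi> x) / s)) \<in> borel_measurable (lebesgue_on \<Omega>)" for s
    by (intro borel_measurable_times U(1) borel_measurable_lebesgue_on) measurable
  show ?thesis
  proof (rule integral_dominated_convergence[where w = "\<lambda>x. C * (B * norm h)"])
    show "AE x in lebesgue_on \<Omega>. (\<lambda>n. U x * ((\<phi> (x + t n *\<^sub>R h) - \<phi> x) / t n))
        \<longlonglongrightarrow> U x * frechet_derivative \<phi> (at x) h"
      by (intro AE_I2 tendsto_mult tendsto_const lim)
    show "(\<lambda>x. U x * frechet_derivative \<phi> (at x) h) \<in> borel_measurable (lebesgue_on \<Omega>)"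
    proof (rule borel_measurable_LIMSEQ_metric[where
          f = "\<lambda>n x. U x * ((\<phi> (x + t n *\<^sub>R h) - \<phi> x) / t n)"])
      show "(\<lambda>x. U x * ((\<phi> (x + t n *\<^sub>R h) - \<phi> x) / t n)) \<in> borel_measurable (lebesgue_on \<Omega>)" for n
        by (rule meas)
    qed (intro tendsto_mult tendsto_const lim)
    show "AE x in lebesgue_on \<Omega>.
        norm (U x * ((\<phi> (x + t n *\<^sub>R h) - \<phi> x) / t n)) \<le> C * (B * norm h)" for n
    proof (rule AE_I2)
      fix x
      have "\<bar>\<phi> (x + t n *\<^sub>R h) - \<phi> x\<bar> \<le> B * norm h * \<bar>t n\<bar>"
        using B(2)[of "x + t n *\<^sub>R h" x] by (simp add: ac_simps)
      \<comment> \<open>\<open>t n\<close> may vanish for finitely many n. The quotient is then 0 by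
        the convention for division, so the bound holds for every n.\<close>
      then have q: "\<bar>(\<phi> (x + t n *\<^sub>R h) - \<phi> x) / t n\<bar> \<le> B * norm h"
        using B(1) by (cases "t n = 0") (auto simp: divide_simps)
      show "norm (U x * ((\<phi> (x + t n *\<^sub>R h) - \<phi> x) / t n)) \<le> C * (B * norm h)"
        unfolding real_norm_def abs_mult by (intro mult_mono U(2) q) (use C in auto)
    qed
  qed (rule meas | simp)+
qed

section \<open>Local integrability and the fundamental lemma of the calculus of variations\<close>

lemma integrable_on_open_indicator:
  fixes g :: "'a::euclidean_space \<Rightarrow> 'b::euclidean_space"
  assumes "open \<Omega>" "K \<subseteq> \<Omega>" "g absolutely_integrable_on K"
  shows "integrable (lebesgue_on \<Omega>) (\<lambda>x. indicator K x *\<^sub>R g x)"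
proof -
  have "(\<lambda>x. indicator \<Omega> x *\<^sub>R indicator K x *\<^sub>R g x) = (\<lambda>x. indicator K x *\<^sub>R g x)"
    using assms(2) by (auto simp: indicator_def fun_eq_iff)
  then show ?thesis
    using assms by (simp add: integrable_restrict_space set_integrable_def)
qed

text \<open>A weak gradient is assumed integrable on compact subsets only. Along a compact
  exhaustion its truncations converge pointwise, which gives measurability on all of Omega.\<close>

lemma borel_measurable_if_locally_integrable:
  fixes g :: "'a::euclidean_space \<Rightarrow> 'b::euclidean_space"
  assumes "open \<Omega>" "\<And>K. compact K \<Longrightarrow> K \<subseteq> \<Omega> \<Longrightarrow> g absolutely_integrable_on K"
  shows "g \<in> borel_measurable (lebesgue_on \<Omega>)"
proof -
  obtain C where C: "\<And>n. compact (C n :: 'a set)" "\<And>n. C n \<subseteq> \<Omega>"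
    "\<And>n. C n \<subseteq> interior (C (Suc n))" "\<Union> (range C) = \<Omega>"
    "\<And>K. \<lbrakk>compact K; K \<subseteq> \<Omega>\<rbrakk> \<Longrightarrow> \<exists>N. \<forall>n\<ge>N. K \<subseteq> C n"
    by (rule open_Union_compact_subsets[OF assms(1)], rule that)
  show ?thesis
  proof (rule borel_measurable_LIMSEQ_metric)
    show "(\<lambda>x. indicator (C n) x *\<^sub>R g x) \<in> borel_measurable (lebesgue_on \<Omega>)" for n
      by (intro borel_measurable_integrable integrable_on_open_indicator assms C)
    show "(\<lambda>n. indicator (C n) x *\<^sub>R g x) \<longlonglongrightarrow> g x" if "x \<in> space (lebesgue_on \<Omega>)" for x
    proof -
      obtain N where "\<forall>n\<ge>N. x \<in> C n" using C(5)[of "{x}"] \<open>x \<in> space _\<close> by auto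
      then show ?thesis
        by (intro tendsto_eventually) (auto simp: eventually_sequentially intro!: exI[of _ N])
    qed
  qed
qed

lemma integrable_test_function_times:
  fixes g :: "'a::euclidean_space \<Rightarrow> 'b::euclidean_space"
  assumes "open \<Omega>" "\<And>K. compact K \<Longrightarrow> K \<subseteq> \<Omega> \<Longrightarrow> g absolutely_integrable_on K"
    and \<phi>: "\<phi> \<in> test_functions \<Omega>"
  shows "integrable (lebesgue_on \<Omega>) (\<lambda>x. \<phi> x *\<^sub>R g x)"
proof -
  obtain K where K: "compact K" "K \<subseteq> \<Omega>" "\<And>x. x \<notin> K \<Longrightarrow> \<phi> x = 0"
    using test_function_support[OF \<phi>] by metis
  obtain B where B: "0 \<le> B" "\<And>x. \<bar>\<phi> x\<bar> \<le> B"
    using test_function_bounded[OF \<phi>] by metis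
  note int = integrable_on_open_indicator[OF assms(1) K(2) assms(2)[OF K(1,2)]]
  have meas: "\<phi> \<in> borel_measurable (lebesgue_on \<Omega>)"
    by (intro borel_measurable_lebesgue_on Ck_borel_measurable[OF test_function_Ck[OF \<phi>, of 0]])
  have "integrable (lebesgue_on \<Omega>) (\<lambda>x. \<phi> x *\<^sub>R indicator K x *\<^sub>R g x)"
  proof (rule Bochner_Integration.integrable_bound)
    show "integrable (lebesgue_on \<Omega>) (\<lambda>x. B *\<^sub>R indicator K x *\<^sub>R g x)"
      using int by (rule integrable_scaleR_right)
    show "(\<lambda>x. \<phi> x *\<^sub>R indicator K x *\<^sub>R g x) \<in> borel_measurable (lebesgue_on \<Omega>)"
      by (rule borel_measurable_scaleR[OF meas borel_measurable_integrable[OF int]])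
    show "AE x in lebesgue_on \<Omega>. norm (\<phi> x *\<^sub>R indicator K x *\<^sub>R g x)
        \<le> norm (B *\<^sub>R indicator K x *\<^sub>R g x)"
      using B by (intro AE_I2) (auto simp: abs_mult intro!: mult_right_mono)
  qed
  moreover have "(\<lambda>x. \<phi> x *\<^sub>R indicator K x *\<^sub>R g x) = (\<lambda>x. \<phi> x *\<^sub>R g x)"
    using K(3) by (fastforce simp: indicator_def)
  ultimately show ?thesis by metis
qed

text \<open>Test functions approximate indicators of compact sets, so nullity can be tested on those
  only. Inner regularity provides a closed subset T with a remainder of small measure, and T is the
  countable union of its intersections with balls.\<close>

lemma null_sets_if_compact_subsets:
  fixes N :: "'a::euclidean_space set"
  assumes "N \<in> sets lebesgue"
    and null: "\<And>K. compact K \<Longrightarrow> K \<subseteq> N \<Longrightarrow> K \<in> null_sets lebesgue"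
  shows "N \<in> null_sets lebesgue"
proof -
  have "emeasure lebesgue N \<le> ennreal e" if "0 < e" for e
  proof -
    obtain T where T: "closed T" "T \<subseteq> N" "N - T \<in> lmeasurable" "emeasure lebesgue (N - T) < ennreal e"
      using sets_lebesgue_inner_closed[OF assms(1) \<open>0 < e\<close>] by metis
    have "(\<Union>n. T \<inter> cball 0 (real n)) \<in> null_sets lebesgue"
      using T(1,2) by (intro null_sets_UN null) (auto intro: closed_Int_compact)
    moreover have "(\<Union>n. T \<inter> cball 0 (real n)) = T"
      using real_arch_simple by auto
    ultimately have "T \<in> null_sets lebesgue" by simp
    then have "emeasure lebesgue (N - T) = emeasure lebesgue N"
      using assms(1) by (intro emeasure_Diff_null_set)
    with T(4) show ?thesis by simp
  qed
  then have "emeasure lebesgue N = 0"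
    by (metis ennreal_le_epsilon add.left_neutral ennreal_0 le_zero_eq)
  with assms(1) show ?thesis by auto
qed

text \<open>If K is a compact part of the set where g < 0, test functions tending to the indicator
  of K show that the integral of g over K is nonnegative, which forces K to be null.\<close>

lemma AE_nonneg_if_test_functions:
  fixes g :: "'a::euclidean_space \<Rightarrow> real"
  assumes "open \<Omega>" and g: "\<And>K. compact K \<Longrightarrow> K \<subseteq> \<Omega> \<Longrightarrow> g absolutely_integrable_on K"
    and test: "\<And>\<phi>. \<phi> \<in> test_functions \<Omega> \<Longrightarrow> (\<And>x. 0 \<le> \<phi> x) \<Longrightarrow>
      0 \<le> (LINT x|lebesgue_on \<Omega>. \<phi> x * g x)"
  shows "AE x in lebesgue_on \<Omega>. 0 \<le> g x"
proof -
  define N where "N = {x \<in> \<Omega>. g x < 0}"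
  have [measurable]: "g \<in> borel_measurable (lebesgue_on \<Omega>)"
    using assms(1) g by (rule borel_measurable_if_locally_integrable)
  have \<Omega>: "\<Omega> \<in> sets lebesgue" using assms(1) by simp
  have "{x \<in> space (lebesgue_on \<Omega>). g x < 0} \<in> sets (lebesgue_on \<Omega>)" by measurable
  then have N: "N \<in> sets (lebesgue_on \<Omega>)" by (simp add: N_def)
  then have "N \<in> sets lebesgue" using \<Omega> by (auto simp: sets_restrict_space_iff)
  moreover have "K \<in> null_sets lebesgue" if K: "compact K" "K \<subseteq> N" for K
  proof (cases "K = {}")
    case False
    have "K \<subseteq> \<Omega>" using K(2) by (auto simp: N_def)
    then obtain r where r: "0 < r" "{x. infdist x K \<le> r} \<subseteq> \<Omega>"
      using compact_in_open_separated[OF False K(1) assms(1)] by metis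
    \<comment> \<open>A fixed compact neighbourhood that contains all the supports below. Since g is
      integrable on it, it supplies the dominating function.\<close>
    define K' where "K' = {x. infdist x K \<le> r}"
    have K': "compact K'" unfolding K'_def using compact_infdist_le[OF False K(1)] r(1) by simp
    have "\<exists>\<phi>. \<phi> \<in> test_functions \<Omega> \<and> (\<forall>x. 0 \<le> \<phi> x) \<and> (\<forall>x. \<phi> x \<le> 1) \<and>
        (\<forall>x\<in>K. 1 - r / real (Suc n) \<le> \<phi> x) \<and> (\<forall>x. r / real (Suc n) \<le> infdist x K \<longrightarrow> \<phi> x = 0)" for n
    proof -
      have "r / real (Suc n) \<le> r" using r(1) by (simp add: field_simps)
      then have "{x. infdist x K \<le> r / real (Suc n)} \<subseteq> \<Omega>" using r(2) by force
      moreover have "0 < r / real (Suc n)" using r(1) by simp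
      ultimately show ?thesis
        using approximate_indicator_compact[OF K(1) False, of "r / real (Suc n)" \<Omega>] by metis
    qed
    then obtain \<phi> where \<phi>: "\<And>n. \<phi> n \<in> test_functions \<Omega>" "\<And>n x. 0 \<le> \<phi> n x" "\<And>n x. \<phi> n x \<le> 1"
      "\<And>n x. x \<in> K \<Longrightarrow> 1 - r / real (Suc n) \<le> \<phi> n x"
      "\<And>n x. r / real (Suc n) \<le> infdist x K \<Longrightarrow> \<phi> n x = 0"
      by metis
    have r_lim: "(\<lambda>n. r / real (Suc n)) \<longlonglongrightarrow> 0"
      by (rule LIMSEQ_Suc[OF lim_const_over_n])
    have \<phi>_lim: "(\<lambda>n. \<phi> n x) \<longlonglongrightarrow> indicator K x" for x
    proof (cases "x \<in> K")
      case True
      have "(\<lambda>n. 1 - r / real (Suc n)) \<longlonglongrightarrow> 1 - 0" by (intro tendsto_intros r_lim)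
      then have "(\<lambda>n. 1 - r / real (Suc n)) \<longlonglongrightarrow> 1" by simp
      then have "(\<lambda>n. \<phi> n x) \<longlonglongrightarrow> 1"
        by (rule tendsto_sandwich[OF _ _ _ tendsto_const, rotated 2])
           (intro always_eventually allI \<phi>(3) \<phi>(4)[OF True])+
      then show ?thesis using True by simp
    next
      case False
      then have "0 < infdist x K"
        using K(1) \<open>K \<noteq> {}\<close> by (simp add: infdist_pos_not_in_closed compact_imp_closed)
      from order_tendstoD(2)[OF r_lim this] have "\<forall>\<^sub>F n in sequentially. \<phi> n x = 0"
        by eventually_elim (simp add: \<phi>(5) del: of_nat_Suc)
      then show ?thesis using False by (simp add: tendsto_eventually)
    qed
    have "(\<lambda>n. LINT x|lebesgue_on \<Omega>. \<phi> n x * g x) \<longlonglongrightarrow> (LINT x|lebesgue_on \<Omega>. indicator K x * g x)"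
    proof (rule integral_dominated_convergence[where w = "\<lambda>x. norm (indicator K' x *\<^sub>R g x)"])
      show "integrable (lebesgue_on \<Omega>) (\<lambda>x. norm (indicator K' x *\<^sub>R g x))"
        using integrable_on_open_indicator[OF assms(1) _ g[OF K']] r(2)
        by (intro integrable_norm) (auto simp: K'_def)
      show meas: "(\<lambda>x. \<phi> n x * g x) \<in> borel_measurable (lebesgue_on \<Omega>)" for n
        by (rule borel_measurable_times[OF borel_measurable_lebesgue_on[OF
              Ck_borel_measurable[OF test_function_Ck[OF \<phi>(1), of 0]]]]) measurable
      show "AE x in lebesgue_on \<Omega>. (\<lambda>n. \<phi> n x * g x) \<longlonglongrightarrow> indicator K x * g x"
        by (intro AE_I2 tendsto_mult \<phi>_lim tendsto_const)
      show "(\<lambda>x. indicator K x * g x) \<in> borel_measurable (lebesgue_on \<Omega>)"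
        by (rule borel_measurable_LIMSEQ_metric[where f = "\<lambda>n x. \<phi> n x * g x", OF meas])
           (intro tendsto_mult \<phi>_lim tendsto_const)
      show "AE x in lebesgue_on \<Omega>. norm (\<phi> n x * g x) \<le> norm (indicator K' x *\<^sub>R g x)" for n
      proof (rule AE_I2)
        fix x
        have "\<bar>\<phi> n x\<bar> \<le> indicator K' x"
        proof (cases "x \<in> K'")
          case False
          have "r / real (Suc n) \<le> r" using r(1) by (simp add: field_simps)
          then show ?thesis using False \<phi>(5)[of n x] by (auto simp: K'_def)
        qed (use \<phi>(2,3) in auto)
        then show "norm (\<phi> n x * g x) \<le> norm (indicator K' x *\<^sub>R g x)"
          by (auto simp: abs_mult intro!: mult_right_mono)
      qed
    qed
    then have "0 \<le> (LINT x|lebesgue_on \<Omega>. indicator K x * g x)"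
      by (rule LIMSEQ_le_const) (use test \<phi>(1,2) in auto)
    moreover have int: "integrable (lebesgue_on \<Omega>) (\<lambda>x. - (indicator K x * g x))"
      using integrable_on_open_indicator[OF assms(1) \<open>K \<subseteq> \<Omega>\<close> g[OF K(1) \<open>K \<subseteq> \<Omega>\<close>]] by simp
    moreover have pos: "AE x in lebesgue_on \<Omega>. 0 \<le> - (indicator K x * g x)"
      using K(2) by (intro AE_I2) (auto simp: N_def indicator_def)
    ultimately have "(LINT x|lebesgue_on \<Omega>. - (indicator K x * g x)) = 0"
      using integral_nonneg_AE[OF pos] by simp
    then have "AE x in lebesgue_on \<Omega>. - (indicator K x * g x) = 0"
      using integral_nonneg_eq_0_iff_AE[OF int pos] by simp
    then have "AE x in lebesgue_on \<Omega>. x \<notin> K"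
      by eventually_elim (use K(2) in \<open>auto simp: N_def indicator_def split: if_splits\<close>)
    then have "AE x in lebesgue. x \<in> \<Omega> \<longrightarrow> x \<notin> K"
      using \<Omega> by (simp add: AE_restrict_space_iff)
    then have "AE x in lebesgue. x \<notin> K"
      by eventually_elim (use \<open>K \<subseteq> \<Omega>\<close> in auto)
    then show ?thesis
      using K(1) by (subst AE_iff_null_sets) (auto dest: lmeasurable_compact)
  qed auto
  ultimately have "N \<in> null_sets lebesgue"
    by (rule null_sets_if_compact_subsets)
  then have "AE x in lebesgue. x \<notin> N" by (rule AE_not_in)
  then have "AE x in lebesgue. x \<in> \<Omega> \<longrightarrow> 0 \<le> g x"
    by eventually_elim (auto simp: N_def)
  then show ?thesis using \<Omega> by (simp add: AE_restrict_space_iff)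
qed

subsection \<open>Weak cluster points of bounded sequences\<close>

text \<open>
  Closing the tails of \<open>D\<close> under midpoints is enough to find an \<open>L\<^sup>2\<close> Cauchy sequence of
  convex combinations: the parallelogram law forces nearly norm-minimal elements to be close.
\<close>

inductive_set midpoint_tail :: "(nat \<Rightarrow> 'a \<Rightarrow> 'b::real_vector) \<Rightarrow> nat \<Rightarrow> ('a \<Rightarrow> 'b) set"
  for D n where
  tail: "n \<le> k \<Longrightarrow> D k \<in> midpoint_tail D n"
| midpoint: "f \<in> midpoint_tail D n \<Longrightarrow> g \<in> midpoint_tail D n \<Longrightarrow>
    (\<lambda>x. (1/2) *\<^sub>R (f x + g x)) \<in> midpoint_tail D n"

lemma midpoint_tail_antimono:
  assumes "m \<le> n" shows "midpoint_tail D n \<subseteq> midpoint_tail D m"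
proof
  show "f \<in> midpoint_tail D m" if "f \<in> midpoint_tail D n" for f
    using that by induction (use assms in \<open>auto intro: midpoint_tail.intros\<close>)
qed

text \<open>No convergence of D itself is claimed. If one particular integral functional converges
  along D to L, it is within any e of L on a whole tail; this survives midpoints, so the limit g of
  suitable combinations has the value L.\<close>

lemma (in finite_measure) weakly_convergent_cluster_point:
  fixes D :: "nat \<Rightarrow> 'a \<Rightarrow> 'b::euclidean_space"
  assumes D: "\<And>n. D n \<in> borel_measurable M" "\<And>n x. norm (D n x) \<le> C"
  obtains g where "g \<in> borel_measurable M" "\<And>x. norm (g x) \<le> C"
    "\<forall>\<phi> B L v. \<phi> \<in> borel_measurable M \<longrightarrow> (\<forall>x. \<bar>\<phi> x\<bar> \<le> B) \<longrightarrow>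
      (\<lambda>n. LINT x|M. \<phi> x * (D n x \<bullet> v)) \<longlonglongrightarrow> L \<longrightarrow> (LINT x|M. \<phi> x * (g x \<bullet> v)) = L"
proof -
  have C: "0 \<le> C" using D(2)[of 0 undefined] norm_ge_zero order_trans by blast
  have mid: "f \<in> borel_measurable M \<and> (\<forall>x. norm (f x) \<le> C)" if "f \<in> midpoint_tail D n" for f n
    using that
  proof induction
    case (midpoint f g)
    have "norm ((1/2) *\<^sub>R (f x + g x)) \<le> C" for x
    proof -
      have "norm (f x) \<le> C" "norm (g x) \<le> C" using midpoint by auto
      then show ?thesis using norm_triangle_ineq[of "f x" "g x"] by simp
    qed
    with midpoint show ?case by (auto simp del: scaleR_add_right)
  qed (use D in auto)
  have int_sq: "integrable M (\<lambda>x. (norm (f x))\<^sup>2)"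
    if "f \<in> borel_measurable M" "\<And>x. norm (f x) \<le> C'" for f :: "'a \<Rightarrow> 'b" and C'
    using that power_mono[OF that(2), of _ 2]
    by (intro integrable_const_bound[where B = "C'\<^sup>2"]) auto
  define I where "I f = (LINT x|M. (norm (f x))\<^sup>2)" for f :: "'a \<Rightarrow> 'b"
  have I_nonneg: "0 \<le> I f" for f unfolding I_def by simp
  \<comment> \<open>The least energy in the n-th tail. It increases with n, because the tails
    shrink, and stays below the energy of \<open>D n\<close>; hence it converges.\<close>
  define d where "d n = Inf (I ` midpoint_tail D n)" for n
  have ne: "I ` midpoint_tail D n \<noteq> {}" for n by (auto intro: midpoint_tail.tail[OF order_refl])
  have bdd: "bdd_below (I ` midpoint_tail D n)" for n by (rule bdd_belowI2[where m = 0]) (rule I_nonneg)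
  have d_le: "d n \<le> I f" if "f \<in> midpoint_tail D n" for n f
    unfolding d_def using bdd that by (intro cInf_lower) auto
  have "mono d"
    unfolding d_def by (intro monoI cInf_superset_mono ne bdd image_mono midpoint_tail_antimono)
  moreover have "d n \<le> C\<^sup>2 * measure M (space M)" for n
  proof -
    have "I (D n) \<le> (LINT x|M. C\<^sup>2)"
      unfolding I_def by (intro integral_mono int_sq[OF D] integrable_const power_mono D) auto
    then show ?thesis using d_le[OF midpoint_tail.tail[OF order_refl, of D n]] by (simp add: mult.commute)
  qed
  ultimately obtain l where l: "d \<longlonglongrightarrow> l"
    using incseq_convergent[of d "C\<^sup>2 * measure M (space M)"] by blast
  have "\<exists>f\<in>midpoint_tail D n. I f < d n + 1 / real (Suc n)" for n
    using cInf_lessD[OF ne, of n "d n + 1 / real (Suc n)"] by (auto simp: d_def)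
  then obtain f where f: "\<And>n. f n \<in> midpoint_tail D n" "\<And>n. I (f n) < d n + 1 / real (Suc n)"
    by metis
  have f_meas[measurable]: "f n \<in> borel_measurable M" and f_le: "norm (f n x) \<le> C" for n x
    using mid[OF f(1)] by auto
  \<comment> \<open>The parallelogram law gives 2 I (f n) + 2 I (f m) - 4 I(midpoint). For m at most
    n the midpoint lies in tail m, so its energy is at least \<open>d m\<close>; the reciprocals
    come from the slack of the near minimisers.\<close>
  define \<epsilon> where "\<epsilon> n m = 2 * (d n - d m) + 2 * (1 / real (Suc n)) + 2 * (1 / real (Suc m))" for n m
  have diff_sq: "I (\<lambda>x. f n x - f m x) \<le> \<epsilon> n m" if "m \<le> n" for m n
  proof -
    have half: "(\<lambda>x. (1/2) *\<^sub>R (f n x + f m x)) \<in> midpoint_tail D m"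
      using f(1)[of m] f(1)[of n] midpoint_tail_antimono[OF that, of D]
      by (intro midpoint_tail.midpoint) auto
    have "(norm (f n x - f m x))\<^sup>2 = 2 * (norm (f n x))\<^sup>2 + 2 * (norm (f m x))\<^sup>2
        - 4 * (norm ((1/2) *\<^sub>R (f n x + f m x)))\<^sup>2" for x
      by (simp add: power2_norm_eq_inner algebra_simps inner_commute)
    moreover have "integrable M (\<lambda>x. (norm (f k x))\<^sup>2)" for k
      by (rule int_sq[OF f_meas f_le])
    moreover have "integrable M (\<lambda>x. (norm ((1/2) *\<^sub>R (f n x + f m x)))\<^sup>2)"
      using mid[OF half] by (intro int_sq) auto
    ultimately have "I (\<lambda>x. f n x - f m x)
        = 2 * I (f n) + 2 * I (f m) - 4 * I (\<lambda>x. (1/2) *\<^sub>R (f n x + f m x))"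
      unfolding I_def by simp
    moreover have "A \<le> 2 * (b - a) + 2 * p + 2 * q"
      if "A = 2 * X + 2 * Y - 4 * Z" "a \<le> Z" "X < b + p" "Y < a + q" for A X Y Z a b p q :: real
      using that by (simp add: algebra_simps)
    ultimately show ?thesis
      using d_le[OF half] f(2)[of n] f(2)[of m] unfolding \<epsilon>_def by blast
  qed
  have small: "\<exists>N. \<forall>n\<ge>N. \<forall>m\<ge>N. I (\<lambda>x. f n x - f m x) < e" if "0 < e" for e
  proof -
    have "(\<lambda>n. 1 / real (Suc n)) \<longlonglongrightarrow> 0" by (rule LIMSEQ_Suc[OF lim_const_over_n])
    then have "\<forall>\<^sub>F n in sequentially. 1 / real (Suc n) < e / 8"
      using that by (intro order_tendstoD(2)) auto
    moreover have "\<forall>\<^sub>F n in sequentially. dist (d n) l < e / 8"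
      using l that by (intro tendstoD) auto
    ultimately have "\<forall>\<^sub>F n in sequentially. 1 / real (Suc n) < e / 8 \<and> dist (d n) l < e / 8"
      by eventually_elim auto
    then obtain N where N: "\<And>n. n \<ge> N \<Longrightarrow> 1 / real (Suc n) < e / 8 \<and> dist (d n) l < e / 8"
      by (auto simp: eventually_sequentially)
    have le: "I (\<lambda>x. f n x - f m x) < e" if "m \<le> n" "N \<le> m" for m n
    proof -
      have "\<bar>d m - l\<bar> < e / 8" "\<bar>d n - l\<bar> < e / 8"
        using N[of m] N[of n] that by (auto simp: dist_real_def)
      then have "\<bar>d n - l\<bar> + \<bar>d m - l\<bar> < e / 8 + e / 8" by (intro add_strict_mono)
      moreover have "d n - d m \<le> \<bar>d n - l\<bar> + \<bar>d m - l\<bar>" by (simp add: abs_real_def)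
      ultimately have "d n - d m < e / 8 + e / 8" by simp
      moreover have "1 / real (Suc m) < e / 8" "1 / real (Suc n) < e / 8"
        using N[of m] N[of n] that by auto
      ultimately have "\<epsilon> n m < 2 * (e / 8 + e / 8) + 2 * (e / 8) + 2 * (e / 8)"
        unfolding \<epsilon>_def by (intro add_strict_mono mult_strict_left_mono) auto
      then show ?thesis using diff_sq[OF that(1)] by simp
    qed
    have sym: "I (\<lambda>x. f n x - f m x) = I (\<lambda>x. f m x - f n x)" for m n
      unfolding I_def by (simp add: norm_minus_commute)
    have "I (\<lambda>x. f n x - f m x) < e" if "N \<le> n" "N \<le> m" for m n
      using le[of m n] le[of n m] sym[of n m] that by (cases "m \<le> n") auto
    then show ?thesis by blast
  qed
  have f_int: "integrable M (f n)" for n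
    by (rule integrable_const_bound[where B = C]) (auto simp: f_le)
  \<comment> \<open>Integrating |a| <= delta + |a|^2 / delta turns smallness in L^2 into smallness
    in L^1, and an L^1 Cauchy sequence has a subsequence that is Cauchy almost everywhere.\<close>
  have L1: "(LINT x|M. norm (f n x - f m x)) \<le> \<delta> * measure M (space M) + I (\<lambda>x. f n x - f m x) / \<delta>"
    if "0 < \<delta>" for \<delta> n m
  proof -
    have int: "integrable M (\<lambda>x. (norm (f n x - f m x))\<^sup>2)"
      by (rule int_sq[where C' = "C + C"])
         (measurable, rule order_trans[OF norm_triangle_ineq4 add_mono[OF f_le f_le]])
    have "norm a \<le> \<delta> + (norm a)\<^sup>2 / \<delta>" for a :: 'b
    proof (cases "norm a \<le> \<delta>")
      case False
      then have "norm a * \<delta> \<le> (norm a)\<^sup>2" by (simp add: power2_eq_square mult_left_mono)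
      then show ?thesis using that by (simp add: field_simps add_increasing)
    qed (use that in \<open>simp add: add_increasing2\<close>)
    then have "(LINT x|M. norm (f n x - f m x)) \<le> (LINT x|M. \<delta> + (norm (f n x - f m x))\<^sup>2 / \<delta>)"
      using int f_int by (intro integral_mono) auto
    also have "\<dots> = \<delta> * measure M (space M) + I (\<lambda>x. f n x - f m x) / \<delta>"
      unfolding I_def using int by simp
    finally show ?thesis .
  qed
  have "\<exists>N. \<forall>i\<ge>N. \<forall>j\<ge>N. (LINT x|M. norm (f i x - f j x)) < e" if "0 < e" for e
  proof -
    \<comment> \<open>Makes the first term of \<open>L1\<close> at most e / 2. The added 1 keeps the
      denominator positive when the total measure is 0.\<close>
    define \<delta> where "\<delta> = e / (2 * (measure M (space M) + 1))"
    have pos: "0 < measure M (space M) + 1" by (simp add: add_nonneg_pos)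
    have \<delta>: "0 < \<delta>" using that pos by (simp add: \<delta>_def)
    have "\<delta> * measure M (space M) \<le> \<delta> * (measure M (space M) + 1)" using \<delta> by simp
    also have "e / (2 * y) * y = e / 2" if "0 < y" for y :: real using that by simp
    from this[OF pos] have "\<delta> * (measure M (space M) + 1) = e / 2" unfolding \<delta>_def .
    finally have "\<delta> * measure M (space M) \<le> e / 2" .
    moreover obtain N where N: "\<And>n m. n \<ge> N \<Longrightarrow> m \<ge> N \<Longrightarrow> I (\<lambda>x. f n x - f m x) < \<delta> * (e / 2)"
      using small[OF mult_pos_pos[OF \<delta> half_gt_zero[OF \<open>0 < e\<close>]]] by blast
    then have "I (\<lambda>x. f n x - f m x) / \<delta> < e / 2" if "n \<ge> N" "m \<ge> N" for n m
      using that \<delta> by (simp add: pos_divide_less_eq mult.commute)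
    ultimately have "(LINT x|M. norm (f n x - f m x)) < e" if "n \<ge> N" "m \<ge> N" for n m
      using order_le_less_trans[OF L1[OF \<delta>, of n m] add_le_less_mono] that
      by (metis field_sum_of_halves)
    then show ?thesis by blast
  qed
  then obtain r where r: "strict_mono r" "AE x in M. Cauchy (\<lambda>i. f (r i) x)"
    using cauchy_L1_AE_cauchy_subseq[of M f, OF f_int] by blast
  \<comment> \<open>The value 0 off the set of convergence keeps the bound by C true at every point,
    not only almost everywhere.\<close>
  define g where "g x = (if Cauchy (\<lambda>i. f (r i) x) then lim (\<lambda>i. f (r i) x) else 0)" for x
  have g_lim: "(\<lambda>i. f (r i) x) \<longlonglongrightarrow> g x" if "Cauchy (\<lambda>i. f (r i) x)" for x
    using that by (simp add: g_def Cauchy_convergent_iff convergent_LIMSEQ_iff)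
  show thesis
  proof
    show g_meas[measurable]: "g \<in> borel_measurable M"
      unfolding g_def[abs_def] by measurable
    show "norm (g x) \<le> C" for x
    proof (cases "Cauchy (\<lambda>i. f (r i) x)")
      case True
      show ?thesis
        by (rule LIMSEQ_le_const2[OF tendsto_norm[OF g_lim[OF True]]]) (auto simp: f_le)
    qed (simp add: g_def C)
    have "(LINT x|M. \<phi> x * (g x \<bullet> v)) = L"
      if [measurable]: "\<phi> \<in> borel_measurable M" and B: "\<forall>x. \<bar>\<phi> x\<bar> \<le> B"
        and L: "(\<lambda>n. LINT x|M. \<phi> x * (D n x \<bullet> v)) \<longlonglongrightarrow> L"
      for \<phi> :: "'a \<Rightarrow> real" and B L v
    proof -
      have B_nonneg: "0 \<le> B" using B abs_ge_zero order_trans by blast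
      have bound: "norm (\<phi> x * (y \<bullet> v)) \<le> B * (C * norm v)" if "norm y \<le> C" for x y
        unfolding real_norm_def abs_mult using B_nonneg C that
        by (intro mult_mono B[rule_format] order_trans[OF Cauchy_Schwarz_ineq2]) auto
      have int: "integrable M (\<lambda>x. \<phi> x * (h x \<bullet> v))"
        if "h \<in> borel_measurable M" "\<And>x. norm (h x) \<le> C" for h
        using that by (intro integrable_const_bound[where B = "B * (C * norm v)"] AE_I2 bound) auto
      have "(\<lambda>i. LINT x|M. \<phi> x * (f (r i) x \<bullet> v)) \<longlonglongrightarrow> (LINT x|M. \<phi> x * (g x \<bullet> v))"
      proof (rule integral_dominated_convergence[where w = "\<lambda>x. B * (C * norm v)"])
        show "AE x in M. (\<lambda>i. \<phi> x * (f (r i) x \<bullet> v)) \<longlonglongrightarrow> \<phi> x * (g x \<bullet> v)"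
          using r(2) by eventually_elim (intro tendsto_intros g_lim)
        show "AE x in M. norm (\<phi> x * (f (r i) x \<bullet> v)) \<le> B * (C * norm v)" for i
          by (intro AE_I2 bound f_le)
      qed (auto intro!: integrable_const)
      moreover have "(\<lambda>i. LINT x|M. \<phi> x * (f (r i) x \<bullet> v)) \<longlonglongrightarrow> L"
      proof (rule metric_LIMSEQ_I)
        fix e :: real assume "0 < e"
        then obtain N where N: "\<And>n. n \<ge> N \<Longrightarrow> dist (LINT x|M. \<phi> x * (D n x \<bullet> v)) L < e"
          using metric_LIMSEQ_D[OF L] by blast
        \<comment> \<open>Being within e of L is a convex condition on the functional's value, hence
          it passes from the tail of D to all midpoints.\<close>
        have "dist (LINT x|M. \<phi> x * (h x \<bullet> v)) L < e" if "h \<in> midpoint_tail D N" for h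
          using that
        proof induction
          case (midpoint h h')
          have "(LINT x|M. \<phi> x * ((1/2) *\<^sub>R (h x + h' x) \<bullet> v))
              = (LINT x|M. (1/2) * (\<phi> x * (h x \<bullet> v)) + (1/2) * (\<phi> x * (h' x \<bullet> v)))"
            by (intro Bochner_Integration.integral_cong) (auto simp: algebra_simps)
          also have "\<dots> = (1/2) * (LINT x|M. \<phi> x * (h x \<bullet> v)) + (1/2) * (LINT x|M. \<phi> x * (h' x \<bullet> v))"
            using int[of h] int[of h'] mid[OF midpoint(1)] mid[OF midpoint(2)] by simp
          finally show ?case using midpoint(3,4) unfolding dist_real_def by linarith
        qed (use N in auto)
        moreover have "f (r i) \<in> midpoint_tail D N" if "N \<le> i" for i
          using f(1)[of "r i"] midpoint_tail_antimono[of N "r i" D] seq_suble[OF r(1), of i] that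
          by fastforce
        ultimately show "\<exists>N. \<forall>i\<ge>N. dist (LINT x|M. \<phi> x * (f (r i) x \<bullet> v)) L < e" by blast
      qed
      ultimately show ?thesis
        using LIMSEQ_unique by blast
    qed
    then show "\<forall>\<phi> B L v. \<phi> \<in> borel_measurable M \<longrightarrow> (\<forall>x. \<bar>\<phi> x\<bar> \<le> B) \<longrightarrow>
      (\<lambda>n. LINT x|M. \<phi> x * (D n x \<bullet> v)) \<longlonglongrightarrow> L \<longrightarrow> (LINT x|M. \<phi> x * (g x \<bullet> v)) = L"
      by blast
  qed
qed

subsection \<open>Lipschitz functions lie in the unit ball\<close>

lemma test_function_derivative:
  assumes "\<phi> \<in> test_functions \<Omega>" "i \<in> Basis"
  shows "(\<lambda>x. frechet_derivative \<phi> (at x) i) \<in> test_functions \<Omega>"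
proof -
  obtain K where K: "compact K" "K \<subseteq> \<Omega>" "\<And>x h. x \<notin> K \<Longrightarrow> frechet_derivative \<phi> (at x) h = 0"
    using test_function_support[OF assms(1)] by metis
  show ?thesis
  proof (rule test_functionsI[OF _ K(1,2)])
    show "Ck k (\<lambda>x. frechet_derivative \<phi> (at x) i)" for k
      using test_function_Ck[OF assms(1), of "Suc k"] assms(2) by simp
  qed (use K(3) in blast)
qed

text \<open>A weak gradient is tested in basis directions only; expanding h in the basis gives every
  direction, as needed for derivatives along segments and for the bound on the norm of G.\<close>

lemma weak_gradient_directional:
  assumes "open \<Omega>" and G: "is_weak_gradient \<Omega> u G" and \<phi>: "\<phi> \<in> test_functions \<Omega>"
  shows "integrable (lebesgue_on \<Omega>) (\<lambda>x. \<phi> x * (G x \<bullet> h))"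
    and "(LINT x|lebesgue_on \<Omega>. \<phi> x * (G x \<bullet> h)) =
      - (LINT x|lebesgue_on \<Omega>. u x * frechet_derivative \<phi> (at x) h)"
proof -
  have loc: "u absolutely_integrable_on K" "G absolutely_integrable_on K" if "compact K" "K \<subseteq> \<Omega>" for K
    using G that by (auto simp: is_weak_gradient_def)
  have int: "integrable (lebesgue_on \<Omega>) (\<lambda>x. \<phi> x *\<^sub>R G x)"
    by (rule integrable_test_function_times[OF assms(1) loc(2) \<phi>])
  have int_inner: "integrable (lebesgue_on \<Omega>) (\<lambda>x. \<phi> x * (G x \<bullet> v))" for v
    using integrable_inner_left[of v "lebesgue_on \<Omega>" "\<lambda>x. \<phi> x *\<^sub>R G x"] int by simp
  then show "integrable (lebesgue_on \<Omega>) (\<lambda>x. \<phi> x * (G x \<bullet> h))" .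
  have int_u: "integrable (lebesgue_on \<Omega>) (\<lambda>x. u x * frechet_derivative \<phi> (at x) i)"
    if "i \<in> Basis" for i
    using integrable_test_function_times[OF assms(1) loc(1) test_function_derivative[OF \<phi> that]]
    by (simp add: mult.commute)
  have "(LINT x|lebesgue_on \<Omega>. \<phi> x * (G x \<bullet> h))
      = (LINT x|lebesgue_on \<Omega>. (\<Sum>i\<in>Basis. (h \<bullet> i) * (\<phi> x * (G x \<bullet> i))))"
    by (subst euclidean_inner) (simp add: sum_distrib_left mult.left_commute mult.commute)
  also have "\<dots> = (\<Sum>i\<in>Basis. (h \<bullet> i) * (LINT x|lebesgue_on \<Omega>. \<phi> x * (G x \<bullet> i)))"
    using int_inner by (subst Bochner_Integration.integral_sum) auto
  also have "\<dots> = (\<Sum>i\<in>Basis. - ((h \<bullet> i) *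
      (LINT x|lebesgue_on \<Omega>. u x * frechet_derivative \<phi> (at x) i)))"
    using G \<phi> by (intro sum.cong) (auto simp: is_weak_gradient_def mult.commute)
  also have "\<dots> = - (LINT x|lebesgue_on \<Omega>. (\<Sum>i\<in>Basis.
      (h \<bullet> i) * (u x * frechet_derivative \<phi> (at x) i)))"
    using int_u by (subst Bochner_Integration.integral_sum) (auto simp: sum_negf)
  also have "\<dots> = - (LINT x|lebesgue_on \<Omega>. u x * frechet_derivative \<phi> (at x) h)"
    by (subst frechet_derivative_Basis[OF test_function_has_derivative[OF \<phi>], of _ h])
       (simp add: sum_distrib_left mult.left_commute)
  finally show "(LINT x|lebesgue_on \<Omega>. \<phi> x * (G x \<bullet> h)) =
      - (LINT x|lebesgue_on \<Omega>. u x * frechet_derivative \<phi> (at x) h)" .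
qed

text \<open>Moves an integral to the measure on the whole space, where translation invariance
  applies.\<close>

lemma integral_lebesgue_on_eq_lborel:
  fixes f :: "'a::euclidean_space \<Rightarrow> real"
  assumes "open \<Omega>" "f \<in> borel_measurable borel" "\<And>x. x \<notin> \<Omega> \<Longrightarrow> f x = 0"
  shows "(LINT x|lebesgue_on \<Omega>. f x) = (LINT x|lborel. f x)"
proof -
  have "(\<lambda>x. indicator \<Omega> x *\<^sub>R f x) = f"
    using assms(3) by (auto simp: indicator_def fun_eq_iff)
  then show ?thesis
    using assms(1,2) by (simp add: integral_restrict_space integral_completion)
qed

lemma integral_lborel_translate:
  fixes f :: "'a::euclidean_space \<Rightarrow> real"
  assumes "f \<in> borel_measurable borel"
  shows "(LINT x|lborel. f (c + x)) = (LINT x|lborel. f x)"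
  using integral_distr[of "(+) c" lborel borel f] assms by (simp add: lborel_distr_plus)

lemma integrable_lborel_bounded_support:
  fixes f :: "'a::euclidean_space \<Rightarrow> real"
  assumes "open \<Omega>" "bounded \<Omega>" "f \<in> borel_measurable borel"
    "\<And>x. x \<notin> \<Omega> \<Longrightarrow> f x = 0" "\<And>x. \<bar>f x\<bar> \<le> B"
  shows "integrable lborel f"
  using assms emeasure_bounded_finite[OF assms(2)]
  by (intro integrableI_bounded_set[where A = \<Omega> and B = B]) auto

lemma absolutely_integrable_on_bounded_measurable:
  fixes f :: "'a::euclidean_space \<Rightarrow> 'b::euclidean_space"
  assumes "open \<Omega>" "bounded \<Omega>" "f \<in> borel_measurable (lebesgue_on \<Omega>)" "\<And>x. norm (f x) \<le> B"
    and "compact K" "K \<subseteq> \<Omega>"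
  shows "f absolutely_integrable_on K"
proof -
  interpret finite_measure "lebesgue_on \<Omega>"
    using assms(1,2) by (intro finite_measure_lebesgue_on lmeasurable_open)
  have "integrable (lebesgue_on \<Omega>) f"
    using assms(3,4) by (intro integrable_const_bound[where B = B]) auto
  then have "f absolutely_integrable_on \<Omega>"
    using assms(1) by (simp add: integrable_restrict_space set_integrable_def)
  then show ?thesis
    by (rule set_integrable_subset[OF _ _ assms(6)])
       (use lmeasurable_compact[OF assms(5)] in auto)
qed

text \<open>With the Lipschitz bound on the whole space, \<open>V x\<close> can be compared with its
  value at any shifted point, even when the shift leaves Omega.\<close>

locale zero_extended_lipschitz =
  fixes \<Omega> :: "'a::euclidean_space set" and V :: "'a \<Rightarrow> real"
  assumes open_domain: "open \<Omega>" and bounded_domain: "bounded \<Omega>"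
    and lipschitz: "\<And>x y. \<bar>V x - V y\<bar> \<le> norm (x - y)"
    and zero_outside: "\<And>x. x \<notin> \<Omega> \<Longrightarrow> V x = 0"
begin

sublocale finite_measure "lebesgue_on \<Omega>"
  using open_domain bounded_domain by (intro finite_measure_lebesgue_on lmeasurable_open)

lemma continuous: "continuous_on A V"
proof -
  have "1-lipschitz_on A V"
    using lipschitz by (intro lipschitz_onI) (auto simp: dist_norm)
  then show ?thesis by (rule lipschitz_on_continuous_on)
qed

lemma V_borel [measurable]: "V \<in> borel_measurable borel"
  by (intro borel_measurable_continuous_onI continuous)

lemma V_bounded: obtains C where "0 \<le> C" "\<And>x. \<bar>V x\<bar> \<le> C"
proof -
  have "V x = 0" if "x \<notin> closure \<Omega>" for x
    using that closure_subset zero_outside by blast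
  moreover have "compact (closure \<Omega>)" using bounded_domain by simp
  ultimately show ?thesis
    using compactly_supported_bounded[OF continuous, of "closure \<Omega>"] that by metis
qed

text \<open>Discrete integration by parts: a translation by s h moves the shift from the test
  function to V. Both factors vanish outside Omega, so no boundary term arises.\<close>

lemma integral_difference_quotient_swap:
  assumes \<phi>: "\<phi> \<in> test_functions \<Omega>"
  shows "(LINT x|lebesgue_on \<Omega>. V x * ((\<phi> (x + s *\<^sub>R h) - \<phi> x) / s)) =
    (LINT x|lebesgue_on \<Omega>. \<phi> x * ((V (x - s *\<^sub>R h) - V x) / s))"
proof -
  have [measurable]: "\<phi> \<in> borel_measurable borel"
    by (rule Ck_borel_measurable[OF test_function_Ck[OF \<phi>, of 0]])
  obtain C where C: "0 \<le> C" "\<And>x. \<bar>V x\<bar> \<le> C" using V_bounded by metis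
  obtain B where B: "0 \<le> B" "\<And>x. \<bar>\<phi> x\<bar> \<le> B" using test_function_bounded[OF \<phi>] by metis
  have \<phi>_0: "\<phi> x = 0" if "x \<notin> \<Omega>" for x by (rule test_function_support[OF \<phi>]) (use that in blast)
  \<comment> \<open>The unshifted factor confines the support of the product to Omega.\<close>
  have int: "integrable lborel (\<lambda>x. V (x + a) * \<phi> (x + b))" if "a = 0 \<or> b = 0" for a b
  proof (rule integrable_lborel_bounded_support[OF open_domain bounded_domain])
    show "(\<lambda>x. V (x + a) * \<phi> (x + b)) \<in> borel_measurable borel" by measurable
    show "V (x + a) * \<phi> (x + b) = 0" if "x \<notin> \<Omega>" for x
      using \<open>a = 0 \<or> b = 0\<close> that zero_outside[of x] \<phi>_0[of x] by auto
    show "\<bar>V (x + a) * \<phi> (x + b)\<bar> \<le> C * B" for x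
      unfolding abs_mult by (intro mult_mono C B abs_ge_zero)
  qed
  have "(LINT x|lborel. V x * \<phi> (x + s *\<^sub>R h)) = (LINT x|lborel. V (x - s *\<^sub>R h) * \<phi> x)"
    using integral_lborel_translate[of "\<lambda>x. V (x - s *\<^sub>R h) * \<phi> x" "s *\<^sub>R h"]
    by (simp add: add.commute)
  then have "(LINT x|lborel. (V x * \<phi> (x + s *\<^sub>R h) - V x * \<phi> x) / s) =
      (LINT x|lborel. (V (x - s *\<^sub>R h) * \<phi> x - V x * \<phi> x) / s)"
    using int[of 0 "s *\<^sub>R h"] int[of "- (s *\<^sub>R h)" 0] int[of 0 0] by simp
  moreover have "(LINT x|lebesgue_on \<Omega>. V x * ((\<phi> (x + s *\<^sub>R h) - \<phi> x) / s)) =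
      (LINT x|lborel. (V x * \<phi> (x + s *\<^sub>R h) - V x * \<phi> x) / s)"
    by (subst integral_lebesgue_on_eq_lborel[OF open_domain])
       (auto simp: zero_outside algebra_simps)
  moreover have "(LINT x|lebesgue_on \<Omega>. \<phi> x * ((V (x - s *\<^sub>R h) - V x) / s)) =
      (LINT x|lborel. (V (x - s *\<^sub>R h) * \<phi> x - V x * \<phi> x) / s)"
    by (subst integral_lebesgue_on_eq_lborel[OF open_domain])
       (auto simp: \<phi>_0 algebra_simps)
  ultimately show ?thesis by (simp only:)
qed

lemma integral_difference_quotient_limit:
  assumes \<phi>: "\<phi> \<in> test_functions \<Omega>" and t: "filterlim t (at 0) sequentially"
  shows "(\<lambda>n. LINT x|lebesgue_on \<Omega>. \<phi> x * ((V x - V (x - t n *\<^sub>R h)) / t n))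
    \<longlonglongrightarrow> - (LINT x|lebesgue_on \<Omega>. V x * frechet_derivative \<phi> (at x) h)"
proof -
  obtain C where C: "\<And>x. \<bar>V x\<bar> \<le> C" using V_bounded by metis
  have "(\<lambda>n. LINT x|lebesgue_on \<Omega>. V x * ((\<phi> (x + t n *\<^sub>R h) - \<phi> x) / t n))
      \<longlonglongrightarrow> (LINT x|lebesgue_on \<Omega>. V x * frechet_derivative \<phi> (at x) h)"
    by (rule integral_difference_quotient_tendsto[OF \<phi> finite_measure_axioms _ C t])
       (intro borel_measurable_lebesgue_on V_borel)
  from tendsto_minus[OF this] show ?thesis
    unfolding integral_difference_quotient_swap[OF \<phi>] integral_minus[symmetric]
    by (simp add: minus_divide_left right_diff_distrib)
qed

lemma difference_quotient_bound: "\<bar>(V x - V (x - s *\<^sub>R h)) / s\<bar> \<le> norm h"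
  using lipschitz[of x "x - s *\<^sub>R h"] by (cases "s = 0") (auto simp: divide_simps mult.commute)

lemma tendsto_at_0_inverse: "filterlim (\<lambda>n. 1 / real (Suc n)) (at 0) sequentially"
  unfolding filterlim_at using LIMSEQ_Suc[OF lim_const_over_n[of 1]] by simp

text \<open>The vector of backward difference quotients is bounded by the dimension, so it has a
  weak cluster point, and testing it against \<open>i\<close> isolates the i-th quotient. The crude
  bound is enough for membership in \<open>Linf\<close>; the sharp one is
  \<open>weak_gradient_le_1\<close>.\<close>

lemma ex_weak_gradient:
  "\<exists>G \<in> Linf \<Omega>. is_weak_gradient \<Omega> V G"
proof -
  define t where "t n = 1 / real (Suc n)" for n
  define D where "D n x = (\<Sum>i\<in>Basis. ((V x - V (x - t n *\<^sub>R i)) / t n) *\<^sub>R i)" for n x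
  have D_inner: "D n x \<bullet> i = (V x - V (x - t n *\<^sub>R i)) / t n" if "i \<in> Basis" for n x i
    using that by (simp add: D_def)
  have D_meas: "D n \<in> borel_measurable (lebesgue_on \<Omega>)" for n
    unfolding D_def[abs_def] by (intro borel_measurable_lebesgue_on) measurable
  have D_norm: "norm (D n x) \<le> real DIM('a)" for n x
  proof -
    have "norm (D n x) \<le> (\<Sum>i\<in>(Basis::'a set). 1)"
      unfolding D_def
    proof (rule sum_norm_le)
      show "norm (((V x - V (x - t n *\<^sub>R i)) / t n) *\<^sub>R i) \<le> 1" if "i \<in> Basis" for i
        using difference_quotient_bound[of x "t n" i] that by simp
    qed
    then show ?thesis by simp
  qed
  obtain G where G: "G \<in> borel_measurable (lebesgue_on \<Omega>)" "\<And>x. norm (G x) \<le> real DIM('a)"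
    "\<forall>\<phi> B L v. \<phi> \<in> borel_measurable (lebesgue_on \<Omega>) \<longrightarrow> (\<forall>x. \<bar>\<phi> x\<bar> \<le> B) \<longrightarrow>
      (\<lambda>n. LINT x|lebesgue_on \<Omega>. \<phi> x * (D n x \<bullet> v)) \<longlonglongrightarrow> L \<longrightarrow>
      (LINT x|lebesgue_on \<Omega>. \<phi> x * (G x \<bullet> v)) = L"
    by (rule weakly_convergent_cluster_point[where D = D, OF D_meas D_norm]) (rule that)
  have "is_weak_gradient \<Omega> V G"
    unfolding is_weak_gradient_def
  proof (intro conjI allI impI ballI; (elim conjE)?)
    fix K assume K: "compact K" "K \<subseteq> \<Omega>"
    obtain C where C: "\<And>x. norm (V x) \<le> C" using V_bounded by (metis real_norm_def)
    show "V absolutely_integrable_on K"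
      using absolutely_integrable_on_bounded_measurable[OF open_domain bounded_domain
          borel_measurable_lebesgue_on[OF V_borel] C K] .
    show "G absolutely_integrable_on K"
      using absolutely_integrable_on_bounded_measurable[OF open_domain bounded_domain G(1,2) K] .
  next
    fix \<phi> and i :: 'a assume \<phi>: "\<phi> \<in> test_functions \<Omega>" and i: "i \<in> Basis"
    obtain B where B: "\<forall>x. \<bar>\<phi> x\<bar> \<le> B" using test_function_bounded[OF \<phi>] by metis
    have "(\<lambda>n. LINT x|lebesgue_on \<Omega>. \<phi> x * (D n x \<bullet> i))
        \<longlonglongrightarrow> - (LINT x|lebesgue_on \<Omega>. V x * frechet_derivative \<phi> (at x) i)"
      unfolding D_inner[OF i] t_def
      by (rule integral_difference_quotient_limit[OF \<phi> tendsto_at_0_inverse])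
    from G(3)[rule_format, OF borel_measurable_lebesgue_on[OF Ck_borel_measurable[OF
            test_function_Ck[OF \<phi>, of 0]]] B[rule_format] this]
    show "(LINT x|lebesgue_on \<Omega>. V x * frechet_derivative \<phi> (at x) i) =
        - (LINT x|lebesgue_on \<Omega>. (G x \<bullet> i) * \<phi> x)"
      by (simp add: mult.commute)
  qed
  moreover have "G \<in> Linf \<Omega>"
  proof -
    have "Linf_norm \<Omega> G \<le> ennreal (real DIM('a))"
      unfolding Linf_norm_def using G(1,2) by (intro esssup_I) (auto intro!: ennreal_leI)
    then show ?thesis using G(1) by (auto simp: Linf_def intro: le_less_trans)
  qed
  ultimately show ?thesis by blast
qed

text \<open>In a fixed direction h the quotients of V are at most |h|, so G x . h <= |h| almost
  everywhere. Once this holds for all h at the same x, taking h = G x bounds the norm of G x by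
  1.\<close>

lemma weak_gradient_le_1:
  assumes G: "is_weak_gradient \<Omega> V G"
  shows "Linf_norm \<Omega> G \<le> 1"
proof -
  have loc: "G absolutely_integrable_on K" if "compact K" "K \<subseteq> \<Omega>" for K
    using G that by (auto simp: is_weak_gradient_def)
  \<comment> \<open>The exceptional null set depends on h, so only countably many directions can be
    treated together. The violating directions form an open set, which would meet a dense H.\<close>
  obtain H :: "'a set" where H: "countable H" "\<And>X. open X \<Longrightarrow> X \<noteq> {} \<Longrightarrow> \<exists>d\<in>H. d \<in> X"
    by (rule countable_dense_setE) (rule that)
  have "AE x in lebesgue_on \<Omega>. 0 \<le> norm h - G x \<bullet> h" for h
  proof (rule AE_nonneg_if_test_functions[OF open_domain])
    fix K assume K: "compact K" "K \<subseteq> \<Omega>"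
    have "(\<lambda>x. norm h) absolutely_integrable_on K"
      by (rule absolutely_integrable_on_bounded_measurable[OF open_domain bounded_domain _ _ K,
            where B = "norm h"]) auto
    then show "(\<lambda>x. norm h - G x \<bullet> h) absolutely_integrable_on K"
      using absolutely_integrable_component loc[OF K]
      by (intro set_integral_diff) (auto simp: set_integrable_def)
  next
    fix \<phi> :: "'a \<Rightarrow> real" assume \<phi>: "\<phi> \<in> test_functions \<Omega>" "\<And>x. 0 \<le> \<phi> x"
    note int = weak_gradient_directional[OF open_domain G \<phi>(1), of h]
    obtain B where B: "\<And>x. \<bar>\<phi> x\<bar> \<le> B" using test_function_bounded[OF \<phi>(1)] by metis
    have meas[measurable]: "\<phi> \<in> borel_measurable borel"
      by (rule Ck_borel_measurable[OF test_function_Ck[OF \<phi>(1), of 0]])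
    have \<phi>_int: "integrable (lebesgue_on \<Omega>) \<phi>"
      using B by (intro integrable_const_bound[where B = B] borel_measurable_lebesgue_on meas) auto
    have "(LINT x|lebesgue_on \<Omega>. \<phi> x * (G x \<bullet> h)) \<le> (LINT x|lebesgue_on \<Omega>. \<phi> x * norm h)"
    proof (rule LIMSEQ_le_const2)
      show "(\<lambda>n. LINT x|lebesgue_on \<Omega>.
          \<phi> x * ((V x - V (x - (1 / real (Suc n)) *\<^sub>R h)) / (1 / real (Suc n))))
          \<longlonglongrightarrow> (LINT x|lebesgue_on \<Omega>. \<phi> x * (G x \<bullet> h))"
        unfolding int(2) by (rule integral_difference_quotient_limit[OF \<phi>(1) tendsto_at_0_inverse])
      have "(LINT x|lebesgue_on \<Omega>. \<phi> x * ((V x - V (x - s *\<^sub>R h)) / s))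
          \<le> (LINT x|lebesgue_on \<Omega>. \<phi> x * norm h)" for s
      proof (rule integral_mono)
        have le: "\<bar>\<phi> x * ((V x - V (x - s *\<^sub>R h)) / s)\<bar> \<le> \<phi> x * norm h" for x
          using mult_left_mono[OF difference_quotient_bound \<phi>(2)] \<phi>(2)[of x]
          by (simp add: abs_mult)
        show "integrable (lebesgue_on \<Omega>) (\<lambda>x. \<phi> x * norm h)" using \<phi>_int by simp
        then show "integrable (lebesgue_on \<Omega>) (\<lambda>x. \<phi> x * ((V x - V (x - s *\<^sub>R h)) / s))"
        proof (rule Bochner_Integration.integrable_bound)
          show "(\<lambda>x. \<phi> x * ((V x - V (x - s *\<^sub>R h)) / s)) \<in> borel_measurable (lebesgue_on \<Omega>)"
            by (intro borel_measurable_lebesgue_on) measurable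
        qed (use le \<phi>(2) in auto)
        show "\<phi> x * ((V x - V (x - s *\<^sub>R h)) / s) \<le> \<phi> x * norm h" for x
          using le[of x] by (rule abs_le_D1)
      qed
      then show "\<exists>N. \<forall>n\<ge>N. (LINT x|lebesgue_on \<Omega>.
          \<phi> x * ((V x - V (x - (1 / real (Suc n)) *\<^sub>R h)) / (1 / real (Suc n))))
          \<le> (LINT x|lebesgue_on \<Omega>. \<phi> x * norm h)" by blast
    qed
    then show "0 \<le> (LINT x|lebesgue_on \<Omega>. \<phi> x * (norm h - G x \<bullet> h))"
      using int(1) \<phi>_int by (simp add: right_diff_distrib)
  qed
  then have "AE x in lebesgue_on \<Omega>. \<forall>h\<in>H. 0 \<le> norm h - G x \<bullet> h"
    using H(1) by (intro AE_ball_countable') auto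
  then have "AE x in lebesgue_on \<Omega>. ennreal (norm (G x)) \<le> 1"
  proof eventually_elim
    case (elim x)
    have "G x \<bullet> h \<le> norm h" for h
    proof (rule ccontr)
      assume "\<not> G x \<bullet> h \<le> norm h"
      then have "h \<in> {h. norm h < G x \<bullet> h}" by simp
      moreover have "open {h. norm h < G x \<bullet> h}"
        by (intro open_Collect_less continuous_intros)
      ultimately obtain d where "d \<in> H" "norm d < G x \<bullet> d" using H(2) by blast
      with elim show False by force
    qed
    from this[of "G x"] have "norm (G x) * norm (G x) \<le> norm (G x) * 1"
      by (simp add: norm_eq_sqrt_inner)
    then have "norm (G x) \<le> 1"
      using mult_le_cancel_left_pos[of "norm (G x)" "norm (G x)" 1] by (cases "G x = 0") auto
    then show ?case by simp
  qed
  moreover have "G \<in> borel_measurable (lebesgue_on \<Omega>)"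
    by (rule borel_measurable_if_locally_integrable[OF open_domain loc])
  ultimately show ?thesis
    unfolding Linf_norm_def by (intro esssup_I) auto
qed

lemma is_cont_rep: "is_cont_rep \<Omega> V V"
  by (simp add: is_cont_rep_def ae_eq_def continuous)

lemma in_B_J: "V \<in> B_J \<Omega>"
proof -
  obtain C where C: "0 \<le> C" "\<And>x. \<bar>V x\<bar> \<le> C" using V_bounded by metis
  have meas: "V \<in> borel_measurable (lebesgue_on \<Omega>)"
    by (intro borel_measurable_lebesgue_on V_borel)
  have "Linf_norm \<Omega> V \<le> ennreal C"
    unfolding Linf_norm_def using meas C by (intro esssup_I) (auto intro!: ennreal_leI)
  then have "V \<in> Linf \<Omega>" using meas by (auto simp: Linf_def intro: le_less_trans)
  then have "V \<in> W1inf \<Omega>" using ex_weak_gradient by (simp add: W1inf_def)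
  moreover have "V x = 0" if "x \<in> frontier \<Omega>" for x
    using that open_domain zero_outside by (simp add: frontier_def interior_open)
  ultimately have "V \<in> W1inf_0 \<Omega>"
    using is_cont_rep by (auto simp: W1inf_0_def)
  moreover have "is_weak_gradient \<Omega> V (weak_gradient \<Omega> V)"
    unfolding weak_gradient_def using ex_weak_gradient someI_ex by metis
  ultimately have "J \<Omega> V \<le> 1"
    by (simp add: J_def weak_gradient_le_1)
  moreover have "integrable (lebesgue_on \<Omega>) (\<lambda>x. (V x)\<^sup>2)"
  proof (rule integrable_const_bound[where B = "C\<^sup>2"])
    show "AE x in lebesgue_on \<Omega>. norm ((V x)\<^sup>2) \<le> C\<^sup>2"
      using power_mono[OF C(2), where n = 2] by simp
  qed (use meas in auto)
  ultimately show ?thesis using meas by (simp add: B_J_def L2_def)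
qed

end

subsection \<open>Functions in the unit ball are Lipschitz\<close>

text \<open>The points of Omega where U and V differ form an open null set, which must be empty;
  continuity extends the agreement to the closure. In particular the boundary values of
  \<open>cont_rep\<close> do not depend on the choice.\<close>

lemma cont_rep_unique:
  assumes "open \<Omega>" "is_cont_rep \<Omega> u U" "is_cont_rep \<Omega> u V" "x \<in> closure \<Omega>"
  shows "U x = V x"
proof -
  define S where "S = \<Omega> \<inter> (\<lambda>x. U x - V x) -` (- {0})"
  have cont: "continuous_on (closure \<Omega>) (\<lambda>x. U x - V x)"
    using assms(2,3) by (auto simp: is_cont_rep_def intro: continuous_intros)
  then have S: "open S"
    unfolding S_def using assms(1) closure_subset[of \<Omega>]
    by (intro continuous_open_preimage) (auto intro: continuous_on_subset)
  have "AE x in lebesgue_on \<Omega>. U x = u x" "AE x in lebesgue_on \<Omega>. V x = u x"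
    using assms(2,3) by (auto simp: is_cont_rep_def ae_eq_def)
  then have "AE x in lebesgue_on \<Omega>. U x = V x" by eventually_elim simp
  then have "AE x in lebesgue. x \<in> \<Omega> \<longrightarrow> U x = V x"
    using assms(1) by (simp add: AE_restrict_space_iff)
  then have "AE x in lebesgue. x \<notin> S" by eventually_elim (auto simp: S_def)
  then have "S \<in> null_sets lebesgue"
    using S by (subst AE_iff_null_sets) auto
  then have "S = {}"
    using S open_not_negligible negligible_iff_null_sets by blast
  then have "U y - V y = 0" if "y \<in> \<Omega>" for y
    using that by (auto simp: S_def)
  from continuous_constant_on_closure[OF cont this assms(4)] show ?thesis by simp
qed

lemma is_weak_gradient_cong:
  assumes "open \<Omega>" "u \<in> borel_measurable (lebesgue_on \<Omega>)" "continuous_on UNIV U"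
    "AE x in lebesgue_on \<Omega>. U x = u x" and G: "is_weak_gradient \<Omega> u G"
  shows "is_weak_gradient \<Omega> U G"
  unfolding is_weak_gradient_def
proof (intro conjI allI impI ballI; (elim conjE)?)
  fix K assume K: "compact K" "K \<subseteq> \<Omega>"
  show "G absolutely_integrable_on K" using G K by (auto simp: is_weak_gradient_def)
  obtain a where "K \<subseteq> cbox (- a) a"
    using bounded_subset_cbox_symmetric compact_imp_bounded[OF K(1)] by metis
  moreover have "U absolutely_integrable_on cbox (- a) a"
    using assms(3) by (intro absolutely_integrable_continuous) (auto intro: continuous_on_subset)
  ultimately show "U absolutely_integrable_on K"
    using lmeasurable_compact[OF K(1)] by (auto intro: set_integrable_subset)
next
  fix \<phi> and i :: 'a assume \<phi>: "\<phi> \<in> test_functions \<Omega>" and i: "i \<in> Basis"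
  have meas: "(\<lambda>x. frechet_derivative \<phi> (at x) i) \<in> borel_measurable borel"
    by (rule Ck_borel_measurable[OF test_function_Ck[OF test_function_derivative[OF \<phi> i], of 0]])
  have "(LINT x|lebesgue_on \<Omega>. U x * frechet_derivative \<phi> (at x) i)
      = (LINT x|lebesgue_on \<Omega>. u x * frechet_derivative \<phi> (at x) i)"
  proof (rule integral_cong_AE)
    show "AE x in lebesgue_on \<Omega>. U x * frechet_derivative \<phi> (at x) i
        = u x * frechet_derivative \<phi> (at x) i"
      using assms(4) by eventually_elim simp
  qed (intro borel_measurable_times borel_measurable_lebesgue_on meas assms(2)
        borel_measurable_continuous_onI assms(3))+
  then show "(LINT x|lebesgue_on \<Omega>. U x * frechet_derivative \<phi> (at x) i) =
      - (LINT x|lebesgue_on \<Omega>. (G x \<bullet> i) * \<phi> x)"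
    using G \<phi> i by (simp add: is_weak_gradient_def)
qed

section \<open>Mollification along segments\<close>

lemma bump_measurable [measurable]: "bump r c \<in> borel_measurable borel"
  by (rule Ck_borel_measurable[OF Ck_bump[of 0]])

text \<open>The dimension enters only through the type, hence the \<open>itself\<close> argument.
  Bumps are not normalised; their common mass is carried along and cancelled at the end of
  \<open>lipschitz_on_segment\<close>.\<close>

definition bump_mass :: "'a::euclidean_space itself \<Rightarrow> real \<Rightarrow> real" where
  "bump_mass _ r = (LINT x|lborel. bump r (0::'a) x)"

lemma bump_mass_pos:
  assumes "0 < r" shows "0 < bump_mass TYPE('a::euclidean_space) r"
proof -
  have "integrable lborel (bump r (0::'a))"
    using bump_eq_0[OF assms, of _ "0::'a"]
    by (intro integrable_lborel_bounded_support[of "ball 0 r" _ 1])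
       (auto simp: bump_def flat_def)
  moreover have "AE x in lborel. 0 \<le> bump r (0::'a) x" by (simp add: bump_nonneg)
  moreover have "(LINT x|lborel. bump r (0::'a) x) \<noteq> 0"
  proof
    assume "(LINT x|lborel. bump r (0::'a) x) = 0"
    then have "AE x in lborel. bump r (0::'a) x = 0"
      using integral_nonneg_eq_0_iff_AE calculation by blast
    then have "AE x in lborel. x \<notin> ball (0::'a) r"
    proof eventually_elim
      case (elim x)
      then show ?case using bump_pos_iff[OF assms, of 0 x] by simp
    qed
    then have "ball (0::'a) r \<in> null_sets lborel"
      by (subst AE_iff_null_sets) auto
    then show False
      using content_ball_pos[OF assms, of "0::'a"] by (simp add: null_sets_def measure_def)
  qed
  ultimately show ?thesis
    using integral_nonneg_AE[where M = lborel and f = "bump r (0::'a)"] by (simp add: bump_mass_def less_le)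
qed

lemma integral_bump:
  fixes c :: "'a::euclidean_space"
  assumes "open \<Omega>" "0 < r" "cball c r \<subseteq> \<Omega>"
  shows "(LINT x|lebesgue_on \<Omega>. bump r c x) = bump_mass TYPE('a) r"
proof -
  have "bump r c x = 0" if "x \<notin> \<Omega>" for x
    using that assms(3) by (intro bump_eq_0[OF assms(2)]) (force simp: dist_norm norm_minus_commute)
  then have "(LINT x|lebesgue_on \<Omega>. bump r c x) = (LINT x|lborel. bump r c x)"
    by (intro integral_lebesgue_on_eq_lborel[OF assms(1)]) auto
  also have "\<dots> = (LINT x|lborel. bump r c (c + x))"
    by (rule integral_lborel_translate[symmetric]) simp
  also have "\<dots> = bump_mass TYPE('a) r"
    by (simp add: bump_mass_def bump_def)
  finally show ?thesis .
qed

text \<open>Moving the centre by k h shifts the argument of the bump by - k h; this sign cancels the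
  one in the definition of the weak gradient. Only the bump at parameter s has to be a test function
  on Omega.\<close>

lemma mollification_DERIV:
  fixes U :: "'a::euclidean_space \<Rightarrow> real"
  assumes "open \<Omega>" "bounded \<Omega>" "U \<in> borel_measurable borel" "\<And>x. \<bar>U x\<bar> \<le> C"
    and G: "is_weak_gradient \<Omega> U G"
    and r: "0 < r" "cball (a + s *\<^sub>R h) r \<subseteq> \<Omega>"
  shows "((\<lambda>t. LINT x|lebesgue_on \<Omega>. U x * bump r (a + t *\<^sub>R h) x) has_real_derivative
    (LINT x|lebesgue_on \<Omega>. bump r (a + s *\<^sub>R h) x * (G x \<bullet> h))) (at s)"
proof -
  interpret finite_measure "lebesgue_on \<Omega>"
    using assms(1,2) by (intro finite_measure_lebesgue_on lmeasurable_open)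
  define \<phi> where "\<phi> = bump r (a + s *\<^sub>R h)"
  have \<phi>: "\<phi> \<in> test_functions \<Omega>"
    unfolding \<phi>_def by (rule bump_test_function[OF r])
  have U_meas: "U \<in> borel_measurable (lebesgue_on \<Omega>)"
    using assms(3) by (rule borel_measurable_lebesgue_on)
  have int: "integrable (lebesgue_on \<Omega>) (\<lambda>x. U x * bump r c x)" for c
  proof (rule integrable_const_bound[where B = "C * 1"])
    show "AE x in lebesgue_on \<Omega>. norm (U x * bump r c x) \<le> C * 1"
      unfolding real_norm_def abs_mult
      by (intro AE_I2 mult_mono assms(4)) (auto simp: bump_def flat_def intro: order_trans[OF _ assms(4)])
  qed (intro borel_measurable_times U_meas borel_measurable_lebesgue_on bump_measurable)
  define F where "F t = (LINT x|lebesgue_on \<Omega>. U x * bump r (a + t *\<^sub>R h) x)" for t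
  have quot: "(F (s + k) - F s) / k
      = (LINT x|lebesgue_on \<Omega>. U x * ((\<phi> (x + k *\<^sub>R (- h)) - \<phi> x) / k))" for k
  proof -
    have "bump r (a + (s + k) *\<^sub>R h) x = \<phi> (x + k *\<^sub>R (- h))" for x
      using bump_translate[of r "a + s *\<^sub>R h" "k *\<^sub>R h" x]
      by (simp add: \<phi>_def scaleR_left_distrib add.assoc)
    then have "F (s + k) - F s
        = (LINT x|lebesgue_on \<Omega>. U x * \<phi> (x + k *\<^sub>R (- h)) - U x * \<phi> x)"
      unfolding F_def using int[of "a + (s + k) *\<^sub>R h"] int[of "a + s *\<^sub>R h"]
      by (simp add: \<phi>_def)
    then show ?thesis by (simp add: right_diff_distrib)
  qed
  have "((\<lambda>k. (F (s + k) - F s) / k) \<longlongrightarrow> (LINT x|lebesgue_on \<Omega>. \<phi> x * (G x \<bullet> h))) (at 0)"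
    unfolding tendsto_at_iff_sequentially
  proof (intro allI impI)
    fix X :: "nat \<Rightarrow> real" assume "\<forall>i. X i \<in> UNIV - {0}" "X \<longlonglongrightarrow> 0"
    then have "filterlim X (at 0) sequentially" by (simp add: filterlim_at)
    from integral_difference_quotient_tendsto[OF \<phi> finite_measure_axioms U_meas assms(4) this, of "- h"]
    have "(\<lambda>n. (F (s + X n) - F s) / X n)
        \<longlonglongrightarrow> (LINT x|lebesgue_on \<Omega>. U x * frechet_derivative \<phi> (at x) (- h))"
      unfolding quot .
    moreover have "(LINT x|lebesgue_on \<Omega>. U x * frechet_derivative \<phi> (at x) (- h))
        = (LINT x|lebesgue_on \<Omega>. \<phi> x * (G x \<bullet> h))"
      using weak_gradient_directional(2)[OF assms(1) G \<phi>, of "- h"] by simp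
    ultimately show "((\<lambda>k. (F (s + k) - F s) / k) \<circ> X)
        \<longlonglongrightarrow> (LINT x|lebesgue_on \<Omega>. \<phi> x * (G x \<bullet> h))"
      by (simp add: comp_def)
  qed
  then show ?thesis
    by (simp add: DERIV_def F_def \<phi>_def)
qed

text \<open>The unnormalised mollification F has slope at most |x - y| times the mass I along the
  segment, by the mean value theorem. At each endpoint F differs from U times I by at most e / 2
  times I.\<close>

lemma lipschitz_on_segment:
  fixes U :: "'a::euclidean_space \<Rightarrow> real"
  assumes \<Omega>: "open \<Omega>" "bounded \<Omega>" and U: "continuous_on UNIV U" "\<And>x. \<bar>U x\<bar> \<le> C"
    and G: "is_weak_gradient \<Omega> U G" "AE x in lebesgue_on \<Omega>. norm (G x) \<le> 1"
    and seg: "closed_segment x y \<subseteq> \<Omega>"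
  shows "\<bar>U x - U y\<bar> \<le> norm (x - y)"
proof (rule field_le_epsilon)
  fix e :: real assume "0 < e"
  interpret finite_measure "lebesgue_on \<Omega>"
    using \<Omega> by (intro finite_measure_lebesgue_on lmeasurable_open)
  have U_borel: "U \<in> borel_measurable borel" by (rule borel_measurable_continuous_onI[OF U(1)])
  have bump_int: "integrable (lebesgue_on \<Omega>) (bump r c)" for r and c :: 'a
    by (rule integrable_const_bound[where B = 1])
       (auto simp: bump_def flat_def intro!: borel_measurable_lebesgue_on)
  have Ubump_int: "integrable (lebesgue_on \<Omega>) (\<lambda>z. U z * bump r c z)" for r c
  proof (rule Bochner_Integration.integrable_bound[OF integrable_mult_right[OF bump_int, of C]])
    show "(\<lambda>z. U z * bump r c z) \<in> borel_measurable (lebesgue_on \<Omega>)"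
      by (intro borel_measurable_lebesgue_on borel_measurable_times U_borel bump_measurable)
    show "AE z in lebesgue_on \<Omega>. norm (U z * bump r c z) \<le> norm (C * bump r c z)"
      by (auto simp: abs_mult intro!: mult_right_mono order_trans[OF U(2)])
  qed
  obtain \<delta> where \<delta>: "0 < \<delta>" "{z. infdist z (closed_segment x y) \<le> \<delta>} \<subseteq> \<Omega>"
    using compact_in_open_separated[OF _ compact_segment \<Omega>(1) seg] by auto
  have "\<exists>d>0. \<forall>z. dist z c < d \<longrightarrow> \<bar>U z - U c\<bar> < e / 2" for c
    using U(1) \<open>0 < e\<close> half_gt_zero[OF \<open>0 < e\<close>]
    unfolding continuous_on_iff dist_real_def by blast
  then obtain d where d: "\<And>c. 0 < d c" "\<And>c z. dist z c < d c \<Longrightarrow> \<bar>U z - U c\<bar> < e / 2"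
    by metis
  \<comment> \<open>The bound by delta keeps the bumps inside Omega along the whole segment; the
    other two give the accuracy e / 2, needed at the endpoints only.\<close>
  define r where "r = min \<delta> (min (d x) (d y))"
  have r: "0 < r" "r \<le> \<delta>" "r \<le> d x" "r \<le> d y" using \<delta>(1) d(1) by (auto simp: r_def)
  have ball: "cball c r \<subseteq> \<Omega>" if "c \<in> closed_segment x y" for c
  proof
    fix z assume "z \<in> cball c r"
    then have "infdist z (closed_segment x y) \<le> \<delta>"
      using infdist_le[OF that, of z] r(2) by (simp add: dist_commute)
    then show "z \<in> \<Omega>" using \<delta>(2) by blast
  qed
  define I where "I = bump_mass TYPE('a) r"
  have I: "0 < I" unfolding I_def by (rule bump_mass_pos[OF r(1)])
  define F where "F c = (LINT z|lebesgue_on \<Omega>. U z * bump r c z)" for c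
  have F_near: "\<bar>F c - U c * I\<bar> \<le> e / 2 * I" if "c \<in> closed_segment x y" "r \<le> d c" for c
  proof -
    have "F c - U c * I = (LINT z|lebesgue_on \<Omega>. (U z - U c) * bump r c z)"
      using Ubump_int bump_int integral_bump[OF \<Omega>(1) r(1) ball[OF that(1)]]
      by (simp add: F_def I_def left_diff_distrib)
    also have "\<bar>\<dots>\<bar> \<le> (LINT z|lebesgue_on \<Omega>. e / 2 * bump r c z)"
    proof (rule integral_abs_bound_integral)
      show "integrable (lebesgue_on \<Omega>) (\<lambda>z. (U z - U c) * bump r c z)"
        using Ubump_int bump_int by (simp add: left_diff_distrib)
      show "integrable (lebesgue_on \<Omega>) (\<lambda>z. e / 2 * bump r c z)"
        using bump_int by simp
      show "\<bar>(U z - U c) * bump r c z\<bar> \<le> e / 2 * bump r c z" for z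
      proof (cases "norm (z - c) < r")
        case True
        then have "\<bar>U z - U c\<bar> < e / 2" using that(2) by (intro d(2)) (simp add: dist_norm)
        from mult_right_mono[OF less_imp_le[OF this] bump_nonneg[of r c z]] show ?thesis
          by (simp add: abs_mult bump_nonneg)
      qed (simp add: bump_eq_0[OF r(1)])
    qed
    also have "\<dots> = e / 2 * I"
      using integral_bump[OF \<Omega>(1) r(1) ball[OF that(1)]] by (simp add: I_def)
    finally show ?thesis .
  qed
  define c where "c t = x + t *\<^sub>R (y - x)" for t
  have c: "c t \<in> closed_segment x y" if "0 \<le> t" "t \<le> 1" for t
    using that by (auto simp: closed_segment_def c_def algebra_simps intro!: exI[of _ t])
  define F' where "F' t = (LINT z|lebesgue_on \<Omega>. bump r (c t) z * (G z \<bullet> (y - x)))" for t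
  have "((\<lambda>t. F (c t)) has_real_derivative F' t) (at t)" if "0 \<le> t" "t \<le> 1" for t
    unfolding F_def F'_def c_def
    by (rule mollification_DERIV[OF \<Omega> U_borel U(2) G(1) r(1)])
       (use ball[OF c[OF that]] in \<open>simp add: c_def\<close>)
  from MVT2[of 0 1, OF _ this] obtain t where t: "0 < t" "t < 1" "F (c 1) - F (c 0) = F' t"
    by auto
  have "\<bar>F' t\<bar> \<le> norm (x - y) * I"
  proof -
    have ball_t: "cball (c t) r \<subseteq> \<Omega>" using t by (intro ball c) auto
    note G_int = weak_gradient_directional(1)[OF \<Omega>(1) G(1) bump_test_function[OF r(1) ball_t]]
    have "\<bar>F' t\<bar> \<le> (LINT z|lebesgue_on \<Omega>. \<bar>bump r (c t) z * (G z \<bullet> (y - x))\<bar>)"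
      unfolding F'_def by (rule integral_abs_bound)
    also have "\<dots> \<le> (LINT z|lebesgue_on \<Omega>. norm (x - y) * bump r (c t) z)"
    proof (rule integral_mono_AE)
      show "AE z in lebesgue_on \<Omega>. \<bar>bump r (c t) z * (G z \<bullet> (y - x))\<bar> \<le> norm (x - y) * bump r (c t) z"
        using G(2)
      proof eventually_elim
        case (elim z)
        have "\<bar>G z \<bullet> (y - x)\<bar> \<le> norm (G z) * norm (y - x)" by (rule Cauchy_Schwarz_ineq2)
        also have "\<dots> \<le> norm (x - y)"
          using mult_right_mono[OF elim, of "norm (y - x)"] by (simp add: norm_minus_commute)
        finally have "\<bar>G z \<bullet> (y - x)\<bar> \<le> norm (x - y)" .
        from mult_left_mono[OF this bump_nonneg[of r "c t" z]] show ?case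
          by (simp add: abs_mult bump_nonneg mult.commute)
      qed
    qed (use G_int bump_int in auto)
    also have "\<dots> = norm (x - y) * I"
      using integral_bump[OF \<Omega>(1) r(1) ball_t] by (simp add: I_def)
    finally show ?thesis .
  qed
  moreover have "c 0 = x" "c 1 = y" by (simp_all add: c_def)
  ultimately have "\<bar>F y - F x\<bar> \<le> norm (x - y) * I" using t(3) by simp
  moreover have "\<bar>F x - U x * I\<bar> \<le> e / 2 * I" "\<bar>F y - U y * I\<bar> \<le> e / 2 * I"
    using F_near r(3,4) by auto
  moreover have "\<bar>U x * I - U y * I\<bar> \<le> \<bar>F x - U x * I\<bar> + \<bar>F y - U y * I\<bar> + \<bar>F y - F x\<bar>"
    by arith
  ultimately have "\<bar>U x * I - U y * I\<bar> \<le> e / 2 * I + e / 2 * I + norm (x - y) * I"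
    by (meson add_mono order_trans)
  moreover have "\<bar>U x - U y\<bar> * I = \<bar>U x * I - U y * I\<bar>"
    using I by (simp add: abs_mult flip: left_diff_distrib)
  moreover have "e / 2 * I + e / 2 * I + norm (x - y) * I = (norm (x - y) + e) * I"
    by (simp add: algebra_simps)
  ultimately have "\<bar>U x - U y\<bar> * I \<le> (norm (x - y) + e) * I" by simp
  then show "\<bar>U x - U y\<bar> \<le> norm (x - y) + e"
    using I by simp
qed

text \<open>If the segment from x to y leaves Omega at p, then U x and U y are bounded by the
  distances to p, whose sum is |x - y| because p lies between them.\<close>

lemma lipschitz_zero_extension:
  fixes U :: "'a::euclidean_space \<Rightarrow> real"
  assumes "open \<Omega>" "continuous_on UNIV U" "\<And>x. x \<notin> \<Omega> \<Longrightarrow> U x = 0"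
    and seg: "\<And>x y. closed_segment x y \<subseteq> \<Omega> \<Longrightarrow> \<bar>U x - U y\<bar> \<le> norm (x - y)"
  shows "\<bar>U x - U y\<bar> \<le> norm (x - y)"
proof -
  have exit: "\<bar>U x\<bar> \<le> norm (x - p)" if "x \<in> \<Omega>" "p \<notin> \<Omega>" for x p
  proof -
    \<comment> \<open>For a nearest point q of the complement, the half-open segment from x to q
      stays inside Omega, so \<open>seg\<close> applies arbitrarily close to q. Continuity then
      reaches q, where U vanishes.\<close>
    obtain q where q: "q \<in> - \<Omega>" "\<And>z. z \<in> - \<Omega> \<Longrightarrow> dist x q \<le> dist x z"
      using distance_attains_inf[of "- \<Omega>" x] assms(1) \<open>p \<notin> \<Omega>\<close> by (auto simp: closed_def)
    have "\<bar>U x - U (x + s *\<^sub>R (q - x))\<bar> \<le> norm (x - q)" if "0 \<le> s" "s < 1" for s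
    proof -
      have "closed_segment x (x + s *\<^sub>R (q - x)) \<subseteq> \<Omega>"
      proof
        fix z assume "z \<in> closed_segment x (x + s *\<^sub>R (q - x))"
        then have "norm (z - x) \<le> norm (s *\<^sub>R (q - x))"
          using segment_bound1 by fastforce
        also have "\<dots> = s * norm (q - x)" using that(1) by simp
        also have "\<dots> < norm (q - x)"
          using that(2) \<open>x \<in> \<Omega>\<close> q(1) by (cases "q = x") auto
        finally show "z \<in> \<Omega>"
          using q(2)[of z] by (force simp: dist_norm norm_minus_commute)
      qed
      from seg[OF this] have "\<bar>U x - U (x + s *\<^sub>R (q - x))\<bar> \<le> s * norm (q - x)"
        using that(1) by simp
      also have "\<dots> \<le> norm (x - q)"
        using that mult_left_le_one_le[of "norm (q - x)" s] by (simp add: norm_minus_commute)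
      finally show ?thesis .
    qed
    then have "\<forall>\<^sub>F s in at_left 1. \<bar>U x - U (x + s *\<^sub>R (q - x))\<bar> \<le> norm (x - q)"
      unfolding eventually_at_left_field by (intro exI[of _ 0]) auto
    moreover have "((\<lambda>s. \<bar>U x - U (x + s *\<^sub>R (q - x))\<bar>) \<longlongrightarrow> \<bar>U x - U (x + 1 *\<^sub>R (q - x))\<bar>) (at_left 1)"
    proof (intro tendsto_intros)
      have "isCont U (x + 1 *\<^sub>R (q - x))"
        using assms(2) by (simp add: continuous_on_eq_continuous_at)
      then show "((\<lambda>s. U (x + s *\<^sub>R (q - x))) \<longlongrightarrow> U (x + 1 *\<^sub>R (q - x))) (at_left 1)"
        by (rule isCont_tendsto_compose) (intro tendsto_intros)
    qed
    ultimately have "\<bar>U x - U (x + 1 *\<^sub>R (q - x))\<bar> \<le> norm (x - q)"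
      by (intro tendsto_upperbound) auto
    then have "\<bar>U x\<bar> \<le> norm (x - q)" using q(1) assms(3)[of q] by simp
    also have "\<dots> \<le> norm (x - p)" using q(2)[of p] that(2) by (simp add: dist_norm)
    finally show ?thesis .
  qed
  show ?thesis
  proof (cases "x \<in> \<Omega>"; cases "y \<in> \<Omega>")
    assume *: "x \<in> \<Omega>" "y \<in> \<Omega>"
    show ?thesis
    proof (cases "closed_segment x y \<subseteq> \<Omega>")
      case False
      then obtain p where p: "p \<in> closed_segment x y" "p \<notin> \<Omega>" by blast
      have "\<bar>U x - U y\<bar> \<le> norm (x - p) + norm (y - p)"
        using exit[OF *(1) p(2)] exit[OF *(2) p(2)] by arith
      also have "\<dots> = norm (x - y)"
        using p(1) unfolding between_mem_segment[symmetric] between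
        by (simp add: dist_norm norm_minus_commute)
      finally show ?thesis .
    qed (rule seg)
  next
    assume "x \<in> \<Omega>" "y \<notin> \<Omega>" then show ?thesis using exit[of x y] assms(3)[of y] by simp
  next
    assume "x \<notin> \<Omega>" "y \<in> \<Omega>" then show ?thesis
      using exit[of y x] assms(3)[of x] by (simp add: norm_minus_commute)
  qed (simp add: assms(3))
qed

lemma continuous_on_zero_extension:
  fixes U :: "'a::euclidean_space \<Rightarrow> real"
  assumes "open \<Omega>" "continuous_on (closure \<Omega>) U" "\<And>x. x \<in> frontier \<Omega> \<Longrightarrow> U x = 0"
  shows "continuous_on UNIV (\<lambda>x. if x \<in> \<Omega> then U x else 0)"
proof -
  have "continuous_on (closure \<Omega> \<union> - \<Omega>) (\<lambda>x. if x \<in> \<Omega> then U x else 0)"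
  proof (rule continuous_on_closed_Un)
    have "continuous_on (closure \<Omega>) (\<lambda>x. if x \<in> \<Omega> then U x else 0) = continuous_on (closure \<Omega>) U"
      using assms(1,3) by (intro continuous_on_cong) (auto simp: frontier_def interior_open)
    then show "continuous_on (closure \<Omega>) (\<lambda>x. if x \<in> \<Omega> then U x else 0)" using assms(2) by simp
    have "continuous_on (- \<Omega>) (\<lambda>x. if x \<in> \<Omega> then U x else 0) = continuous_on (- \<Omega>) (\<lambda>x. 0::real)"
      by (intro continuous_on_cong) auto
    then show "continuous_on (- \<Omega>) (\<lambda>x. if x \<in> \<Omega> then U x else 0)" by simp
  qed (use assms(1) in \<open>auto simp: closed_def\<close>)
  moreover have "closure \<Omega> \<union> - \<Omega> = UNIV" using closure_subset by blast
  ultimately show ?thesis by simp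
qed

text \<open>\<open>cont_rep\<close> is an arbitrary choice off the closure of Omega, so the
  Lipschitz bound on the whole space is stated for the extension by zero.\<close>

lemma B_J_cont_rep:
  fixes u :: "'a::euclidean_space \<Rightarrow> real"
  assumes \<Omega>: "open \<Omega>" "bounded \<Omega>" and u: "u \<in> B_J \<Omega>"
  shows "is_cont_rep \<Omega> u (cont_rep \<Omega> u)"
    and "\<And>x. x \<in> frontier \<Omega> \<Longrightarrow> cont_rep \<Omega> u x = 0"
    and "zero_extended_lipschitz \<Omega> (\<lambda>x. if x \<in> \<Omega> then cont_rep \<Omega> u x else 0)"
proof -
  let ?U = "cont_rep \<Omega> u" and ?W = "\<lambda>x. if x \<in> \<Omega> then cont_rep \<Omega> u x else 0"
  have "J \<Omega> u \<le> 1" and u_meas: "u \<in> borel_measurable (lebesgue_on \<Omega>)"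
    using u by (auto simp: B_J_def L2_def)
  then have W: "u \<in> W1inf_0 \<Omega>" and G_le: "Linf_norm \<Omega> (weak_gradient \<Omega> u) \<le> 1"
    by (auto simp: J_def top_unique split: if_splits)
  obtain U where U: "is_cont_rep \<Omega> u U" "\<And>x. x \<in> frontier \<Omega> \<Longrightarrow> U x = 0"
    using W by (auto simp: W1inf_0_def)
  show rep: "is_cont_rep \<Omega> u ?U"
    unfolding cont_rep_def by (rule someI[of "is_cont_rep \<Omega> u", OF U(1)])
  show zero: "?U x = 0" if "x \<in> frontier \<Omega>" for x
    using cont_rep_unique[OF \<Omega>(1) rep U(1)] U(2) that by (simp add: frontier_def)
  have G: "is_weak_gradient \<Omega> u (weak_gradient \<Omega> u)"
    using W someI_ex[of "is_weak_gradient \<Omega> u"]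
    unfolding weak_gradient_def W1inf_0_def W1inf_def by blast
  have cont: "continuous_on UNIV ?W"
    using rep zero by (intro continuous_on_zero_extension \<Omega>) (auto simp: is_cont_rep_def)
  have "AE x in lebesgue_on \<Omega>. ?U x = u x" using rep by (simp add: is_cont_rep_def ae_eq_def)
  moreover have "AE x in lebesgue_on \<Omega>. x \<in> \<Omega>" by (rule AE_I2) simp
  ultimately have "AE x in lebesgue_on \<Omega>. ?W x = u x" by eventually_elim simp
  then have G0: "is_weak_gradient \<Omega> ?W (weak_gradient \<Omega> u)"
    by (rule is_weak_gradient_cong[OF \<Omega>(1) u_meas cont _ G])
  have "AE x in lebesgue_on \<Omega>. ennreal (norm (weak_gradient \<Omega> u x)) \<le> Linf_norm \<Omega> (weak_gradient \<Omega> u)"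
    unfolding Linf_norm_def by (rule esssup_AE)
  then have G_AE: "AE x in lebesgue_on \<Omega>. norm (weak_gradient \<Omega> u x) \<le> 1"
  proof eventually_elim
    case (elim x)
    then have "ennreal (norm (weak_gradient \<Omega> u x)) \<le> 1" using G_le by (rule order_trans)
    then show ?case by simp
  qed
  have "compact (closure \<Omega>)" using \<Omega>(2) by simp
  moreover have "?W x = 0" if "x \<notin> closure \<Omega>" for x using that closure_subset by auto
  ultimately obtain C where C: "\<And>x. \<bar>?W x\<bar> \<le> C"
    using compactly_supported_bounded[OF cont, of "closure \<Omega>"] by blast
  have "\<bar>?W x - ?W y\<bar> \<le> norm (x - y)" if "closed_segment x y \<subseteq> \<Omega>" for x y
    by (rule lipschitz_on_segment[OF \<Omega> cont C G0 G_AE that])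
  note lipschitz_zero_extension[OF \<Omega>(1) cont _ this]
  then show "zero_extended_lipschitz \<Omega> ?W"
    using \<Omega> by unfold_locales auto
qed

subsection \<open>Chains and extreme points\<close>

lemma B_J_lipschitz:
  assumes "open \<Omega>" "bounded \<Omega>" "u \<in> B_J \<Omega>" "x \<in> closure \<Omega>" "y \<in> closure \<Omega>"
  shows "\<bar>cont_rep \<Omega> u x - cont_rep \<Omega> u y\<bar> \<le> norm (x - y)"
proof -
  have "(if z \<in> \<Omega> then cont_rep \<Omega> u z else 0) = cont_rep \<Omega> u z" if "z \<in> closure \<Omega>" for z
    using that B_J_cont_rep(2)[OF assms(1-3), of z] assms(1) by (simp add: frontier_def interior_open)
  then show ?thesis
    using zero_extended_lipschitz.lipschitz[OF B_J_cont_rep(3)[OF assms(1-3)], of x y] assms(4,5)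
    by simp
qed

text \<open>A segment from Omega to its complement meets the frontier, where V vanishes; this
  reduces the mixed case to the bound on the closure.\<close>

lemma zero_extended_lipschitzI:
  fixes V :: "'a::euclidean_space \<Rightarrow> real"
  assumes "open \<Omega>" "bounded \<Omega>" "\<And>x. x \<in> frontier \<Omega> \<Longrightarrow> V x = 0"
    and V: "\<And>x y. x \<in> closure \<Omega> \<Longrightarrow> y \<in> closure \<Omega> \<Longrightarrow> \<bar>V x - V y\<bar> \<le> norm (x - y)"
  shows "zero_extended_lipschitz \<Omega> (\<lambda>x. if x \<in> \<Omega> then V x else 0)"
proof
  have exit: "\<bar>V x\<bar> \<le> norm (x - y)" if "x \<in> \<Omega>" "y \<notin> \<Omega>" for x y
  proof -
    have "closed_segment x y \<inter> frontier \<Omega> \<noteq> {}"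
      using that by (intro connected_Int_frontier) auto
    then obtain z where z: "z \<in> closed_segment x y" "z \<in> frontier \<Omega>" by blast
    have "\<bar>V x - V z\<bar> \<le> norm (x - z)"
      using that(1) z(2) closure_subset by (intro V) (auto simp: frontier_def)
    also have "\<dots> \<le> norm (x - y)"
      using segment_bound1[OF z(1)] by (simp add: norm_minus_commute)
    finally show ?thesis using assms(3)[OF z(2)] by simp
  qed
  show "\<bar>(if x \<in> \<Omega> then V x else 0) - (if y \<in> \<Omega> then V y else 0)\<bar> \<le> norm (x - y)" for x y
    using exit[of x y] exit[of y x] V[of x y] closure_subset[of \<Omega>]
    by (auto simp: norm_minus_commute)
qed (use assms in auto)

section \<open>Chains and their costs\<close>

definition chain_cost :: "'a::euclidean_space set \<Rightarrow> ('a \<Rightarrow> real) \<Rightarrow> 'a \<Rightarrow> 'a \<Rightarrow> real \<Rightarrow> bool" where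
  "chain_cost \<Omega> u x z \<epsilon> \<longleftrightarrow> 0 < \<epsilon> \<and>
     (\<exists>(m::nat) (p::nat \<Rightarrow> 'a) (e::nat \<Rightarrow> real).
        p 0 = z \<and> p m = x \<and> (\<forall>i\<le>m. p i \<in> closure \<Omega>) \<and>
        (\<forall>i\<in>{1..m}. 0 \<le> e i) \<and> (\<Sum>i=1..m. e i) \<le> \<epsilon> \<and>
        (\<forall>i\<in>{1..m}. norm (p (i - 1) - p i) - e i \<le> \<bar>u (p (i - 1)) - u (p i)\<bar>))"

lemma eps_eq_Inf_chain_cost: "eps \<Omega> u x z = Inf (Collect (chain_cost \<Omega> u x z))"
  by (simp only: eps_def chain_cost_def[abs_def])

text \<open>This is the chain with m = 0: its sum of defects is empty, so every positive number is
  an admissible cost.\<close>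

lemma chain_cost_self: "z \<in> closure \<Omega> \<Longrightarrow> 0 < \<epsilon> \<Longrightarrow> chain_cost \<Omega> u z z \<epsilon>"
  unfolding chain_cost_def by (intro conjI exI[of _ 0] exI[of _ "\<lambda>_. z"] exI[of _ "\<lambda>_. 0"]) auto

text \<open>Chains start at z, so the new point is appended at the far end and z stays fixed. This
  is what later allows an infimum over z.\<close>

lemma chain_cost_step:
  assumes "chain_cost \<Omega> u x z \<epsilon>" "y \<in> closure \<Omega>" "0 \<le> d" "norm (x - y) - d \<le> \<bar>u x - u y\<bar>"
  shows "chain_cost \<Omega> u y z (\<epsilon> + d)"
proof -
  obtain m :: nat and p e where *: "0 < \<epsilon>" "p 0 = z" "p m = x" "\<forall>i\<le>m. p i \<in> closure \<Omega>"
    "\<forall>i\<in>{1..m}. 0 \<le> e i" "(\<Sum>i=1..m. e i) \<le> \<epsilon>"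
    "\<forall>i\<in>{1..m}. norm (p (i - 1) - p i) - e i \<le> \<bar>u (p (i - 1)) - u (p i)\<bar>"
    using assms(1) unfolding chain_cost_def by blast
  define p' where "p' = p(Suc m := y)"
  define e' where "e' = e(Suc m := d)"
  have "(\<Sum>i=1..m. e' i) = (\<Sum>i=1..m. e i)" by (intro sum.cong) (auto simp: e'_def)
  then have "(\<Sum>i=1..Suc m. e' i) \<le> \<epsilon> + d" using *(6) by (simp add: e'_def)
  moreover have "norm (p' (i - 1) - p' i) - e' i \<le> \<bar>u (p' (i - 1)) - u (p' i)\<bar>"
    if "i \<in> {1..Suc m}" for i
    using *(3,7) assms(4) that by (cases "i = Suc m") (auto simp: p'_def e'_def)
  moreover have "\<forall>i\<in>{1..Suc m}. 0 \<le> e' i" "\<forall>i\<le>Suc m. p' i \<in> closure \<Omega>"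
    using *(4,5) assms(2,3) by (auto simp: p'_def e'_def)
  moreover have "p' 0 = z" "p' (Suc m) = y" "0 < \<epsilon> + d"
    using *(1,2) assms(3) by (auto simp: p'_def)
  ultimately show ?thesis unfolding chain_cost_def by blast
qed

text \<open>Shows that the infimum in \<open>eps\<close> is over a nonempty set. Costs must be
  positive, so the trivial chain at z is given the cost 1.\<close>

lemma chain_cost_direct:
  assumes "x \<in> closure \<Omega>" "z \<in> closure \<Omega>"
  shows "chain_cost \<Omega> u x z (1 + norm (z - x))"
  using assms by (intro chain_cost_step[OF chain_cost_self]) auto

lemma chain_cost_pos: "chain_cost \<Omega> u x z \<epsilon> \<Longrightarrow> 0 < \<epsilon>"
  by (simp add: chain_cost_def)

lemma bdd_below_chain_cost: "bdd_below (Collect (chain_cost \<Omega> u x z))"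
  by (rule bdd_belowI[of _ 0]) (auto dest: chain_cost_pos)

lemma eps_le: "chain_cost \<Omega> u x z \<epsilon> \<Longrightarrow> eps \<Omega> u x z \<le> \<epsilon>"
  unfolding eps_eq_Inf_chain_cost by (rule cInf_lower[OF _ bdd_below_chain_cost]) simp

lemma eps_greatest:
  assumes "x \<in> closure \<Omega>" "z \<in> closure \<Omega>" "\<And>\<epsilon>. chain_cost \<Omega> u x z \<epsilon> \<Longrightarrow> c \<le> \<epsilon>"
  shows "c \<le> eps \<Omega> u x z"
  unfolding eps_eq_Inf_chain_cost
  using chain_cost_direct[OF assms(1,2)] assms(3) by (intro cInf_greatest) auto

lemma eps_nonneg: "x \<in> closure \<Omega> \<Longrightarrow> z \<in> closure \<Omega> \<Longrightarrow> 0 \<le> eps \<Omega> u x z"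
  by (rule eps_greatest) (auto dest: chain_cost_pos)

lemma eps_self:
  assumes "z \<in> closure \<Omega>"
  shows "eps \<Omega> u z z = 0"
proof (rule antisym)
  show "eps \<Omega> u z z \<le> 0"
    by (rule field_le_epsilon) (simp add: eps_le chain_cost_self assms)
qed (rule eps_nonneg[OF assms assms])

text \<open>The Lipschitz hypothesis makes the defect of the step from x to y nonnegative, hence
  admissible as the \<open>d\<close> of \<open>chain_cost_step\<close>.\<close>

lemma eps_step:
  assumes "x \<in> closure \<Omega>" "y \<in> closure \<Omega>" "z \<in> closure \<Omega>" "\<bar>u x - u y\<bar> \<le> norm (x - y)"
  shows "eps \<Omega> u y z \<le> eps \<Omega> u x z + (norm (x - y) - \<bar>u x - u y\<bar>)"
proof -
  have "eps \<Omega> u y z - (norm (x - y) - \<bar>u x - u y\<bar>) \<le> \<epsilon>" if "chain_cost \<Omega> u x z \<epsilon>" for \<epsilon>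
    using eps_le[OF chain_cost_step[OF that assms(2)], of "norm (x - y) - \<bar>u x - u y\<bar>"] assms(4)
    by simp
  from eps_greatest[where u = u, OF assms(1,3) this] show ?thesis by simp
qed

section \<open>The infimum over the boundary\<close>

definition boundary_defect :: "'a::euclidean_space set \<Rightarrow> ('a \<Rightarrow> real) \<Rightarrow> 'a \<Rightarrow> real" where
  "boundary_defect \<Omega> u x = (INF z\<in>frontier \<Omega>. eps \<Omega> u x z)"

lemma frontier_subset_closure: "z \<in> frontier \<Omega> \<Longrightarrow> z \<in> closure \<Omega>"
  by (simp add: frontier_def)

lemma bdd_below_eps: "x \<in> closure \<Omega> \<Longrightarrow> bdd_below (eps \<Omega> u x ` frontier \<Omega>)"
  by (rule bdd_belowI2[of _ 0]) (auto intro: eps_nonneg frontier_subset_closure)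

lemma boundary_defect_frontier:
  assumes "x \<in> frontier \<Omega>"
  shows "boundary_defect \<Omega> u x = 0"
proof (rule antisym)
  show "boundary_defect \<Omega> u x \<le> 0"
    using cINF_lower[OF bdd_below_eps assms] eps_self frontier_subset_closure[OF assms]
    unfolding boundary_defect_def by metis
  show "0 \<le> boundary_defect \<Omega> u x"
    unfolding boundary_defect_def using assms
    by (intro cINF_greatest eps_nonneg frontier_subset_closure) auto
qed

text \<open>\<open>eps_step\<close> holds with the same z on both sides, so it survives the infimum
  over z; exchanging the two points gives the absolute value.\<close>

lemma boundary_defect_diff:
  assumes "frontier \<Omega> \<noteq> {}" "x \<in> closure \<Omega>" "y \<in> closure \<Omega>" "\<bar>u x - u y\<bar> \<le> norm (x - y)"
  shows "\<bar>boundary_defect \<Omega> u x - boundary_defect \<Omega> u y\<bar> \<le> norm (x - y) - \<bar>u x - u y\<bar>"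
proof -
  have le: "boundary_defect \<Omega> u b \<le> boundary_defect \<Omega> u a + (norm (a - b) - \<bar>u a - u b\<bar>)"
    if "a \<in> closure \<Omega>" "b \<in> closure \<Omega>" "\<bar>u a - u b\<bar> \<le> norm (a - b)" for a b
  proof -
    have "boundary_defect \<Omega> u b - (norm (a - b) - \<bar>u a - u b\<bar>) \<le> eps \<Omega> u a z"
      if "z \<in> frontier \<Omega>" for z
      using cINF_lower[OF bdd_below_eps[OF \<open>b \<in> closure \<Omega>\<close>] that, of u]
        eps_step[OF \<open>a \<in> closure \<Omega>\<close> \<open>b \<in> closure \<Omega>\<close> frontier_subset_closure[OF that]
          \<open>\<bar>u a - u b\<bar> \<le> norm (a - b)\<close>]
      unfolding boundary_defect_def by simp
    then have "boundary_defect \<Omega> u b - (norm (a - b) - \<bar>u a - u b\<bar>) \<le> boundary_defect \<Omega> u a"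
      unfolding boundary_defect_def[of \<Omega> u a] by (intro cINF_greatest assms(1))
    then show ?thesis by simp
  qed
  show ?thesis
    using le[OF assms(2,3,4)] le[OF assms(3,2)] assms(4)
    by (simp add: abs_le_iff abs_minus_commute norm_minus_commute)
qed

text \<open>Here a and b are the increments of v and w over a step of length d with defect e. If the
  average is at least d - e and a is the larger number, then (1 - l)(a - b) = a - average <= e; if b
  is larger, the factor is l. The minimum covers both orders, and a negative average is
  reflected.\<close>

lemma almost_extremal_combination:
  fixes a b d e l :: real
  assumes "0 < l" "l < 1" "\<bar>a\<bar> \<le> d" "\<bar>b\<bar> \<le> d" "d - e \<le> \<bar>l * a + (1 - l) * b\<bar>"
  shows "min l (1 - l) * \<bar>a - b\<bar> \<le> e"
proof -
  have pos: "min l (1 - l) * \<bar>a - b\<bar> \<le> e"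
    if "\<bar>a\<bar> \<le> d" "\<bar>b\<bar> \<le> d" "d - e \<le> l * a + (1 - l) * b" for a b
  proof (cases "b \<le> a")
    case True
    have "min l (1 - l) * (a - b) \<le> (1 - l) * (a - b)"
      using True by (intro mult_right_mono) auto
    also have "\<dots> = a - (l * a + (1 - l) * b)" by (simp add: algebra_simps)
    also have "\<dots> \<le> e" using that by simp
    finally show ?thesis using True by simp
  next
    case False
    have "min l (1 - l) * (b - a) \<le> l * (b - a)"
      using False by (intro mult_right_mono) auto
    also have "\<dots> = b - (l * a + (1 - l) * b)" by (simp add: algebra_simps)
    also have "\<dots> \<le> e" using that by simp
    finally show ?thesis using False by simp
  qed
  show ?thesis
  proof (cases "0 \<le> l * a + (1 - l) * b")
    case True
    then show ?thesis using pos[of a b] assms by simp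
  next
    case False
    then have "d - e \<le> l * (- a) + (1 - l) * (- b)" using assms(5) by simp
    then show ?thesis using pos[of "- a" "- b"] assms(3,4) by (simp add: abs_minus_commute)
  qed
qed

lemma chain_cost_convex_combination:
  fixes v w :: "'a::euclidean_space \<Rightarrow> real"
  assumes l: "0 < l" "l < 1"
    and v: "\<And>x y. x \<in> closure \<Omega> \<Longrightarrow> y \<in> closure \<Omega> \<Longrightarrow> \<bar>v x - v y\<bar> \<le> norm (x - y)"
    and w: "\<And>x y. x \<in> closure \<Omega> \<Longrightarrow> y \<in> closure \<Omega> \<Longrightarrow> \<bar>w x - w y\<bar> \<le> norm (x - y)"
    and u: "\<And>x. x \<in> closure \<Omega> \<Longrightarrow> u x = l * v x + (1 - l) * w x"
    and "v z = w z" "chain_cost \<Omega> u x z \<epsilon>"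
  shows "min l (1 - l) * \<bar>v x - w x\<bar> \<le> \<epsilon>"
proof -
  obtain m :: nat and p e where p: "p 0 = z" "p m = x" "\<forall>i\<le>m. p i \<in> closure \<Omega>"
    and e: "\<forall>i\<in>{1..m}. 0 \<le> e i" "(\<Sum>i=1..m. e i) \<le> \<epsilon>"
    and step: "\<forall>i\<in>{1..m}. norm (p (i - 1) - p i) - e i \<le> \<bar>u (p (i - 1)) - u (p i)\<bar>"
    using assms(7) unfolding chain_cost_def by blast
  let ?c = "min l (1 - l)"
  \<comment> \<open>The difference of v and w is 0 at the start z of the chain, and each step adds
    at most its own defect after scaling by \<open>?c\<close>.\<close>
  have "?c * \<bar>v (p k) - w (p k)\<bar> \<le> (\<Sum>i=1..k. e i)" if "k \<le> m" for k
    using that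
  proof (induction k)
    case 0
    then show ?case using p(1) assms(6) by simp
  next
    case (Suc k)
    have cl: "p k \<in> closure \<Omega>" "p (Suc k) \<in> closure \<Omega>" using p(3) Suc.prems by auto
    have "norm (p k - p (Suc k)) - e (Suc k) \<le> \<bar>u (p k) - u (p (Suc k))\<bar>"
      using step Suc.prems by (metis One_nat_def Suc_le_mono atLeastAtMost_iff diff_Suc_1 zero_le)
    also have "u (p k) - u (p (Suc k))
        = l * (v (p k) - v (p (Suc k))) + (1 - l) * (w (p k) - w (p (Suc k)))"
      unfolding u[OF cl(1)] u[OF cl(2)] by (simp add: algebra_simps)
    finally have "?c * \<bar>(v (p k) - v (p (Suc k))) - (w (p k) - w (p (Suc k)))\<bar> \<le> e (Suc k)"
      by (rule almost_extremal_combination[OF l v[OF cl] w[OF cl]])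
    moreover have "\<bar>v (p (Suc k)) - w (p (Suc k))\<bar> \<le> \<bar>v (p k) - w (p k)\<bar>
        + \<bar>(v (p k) - v (p (Suc k))) - (w (p k) - w (p (Suc k)))\<bar>"
      by arith
    then have "?c * \<bar>v (p (Suc k)) - w (p (Suc k))\<bar> \<le> ?c * \<bar>v (p k) - w (p k)\<bar>
        + ?c * \<bar>(v (p k) - v (p (Suc k))) - (w (p k) - w (p (Suc k)))\<bar>"
      using l by (metis distrib_left min_less_iff_conj mult_left_mono less_imp_le diff_gt_0_iff_gt)
    ultimately show ?case using Suc by simp
  qed
  from this[of m] show ?thesis using p(2) e(2) by simp
qed

lemma boundary_defect_0_convex_combination:
  fixes v w :: "'a::euclidean_space \<Rightarrow> real"
  assumes l: "0 < l" "l < 1"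
    and v: "\<And>x y. x \<in> closure \<Omega> \<Longrightarrow> y \<in> closure \<Omega> \<Longrightarrow> \<bar>v x - v y\<bar> \<le> norm (x - y)"
    and w: "\<And>x y. x \<in> closure \<Omega> \<Longrightarrow> y \<in> closure \<Omega> \<Longrightarrow> \<bar>w x - w y\<bar> \<le> norm (x - y)"
    and u: "\<And>x. x \<in> closure \<Omega> \<Longrightarrow> u x = l * v x + (1 - l) * w x"
    and frontier: "frontier \<Omega> \<noteq> {}" "\<And>z. z \<in> frontier \<Omega> \<Longrightarrow> v z = w z"
    and x: "x \<in> closure \<Omega>" "boundary_defect \<Omega> u x = 0"
  shows "v x = w x"
proof -
  have "min l (1 - l) * \<bar>v x - w x\<bar> \<le> 0 + \<epsilon>" if "0 < \<epsilon>" for \<epsilon>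
  proof -
    \<comment> \<open>Neither infimum need be attained: a boundary point and then a chain are picked
      whose cost is still below the given number.\<close>
    obtain z where z: "z \<in> frontier \<Omega>" "eps \<Omega> u x z < \<epsilon>"
      using cINF_less_iff[OF frontier(1) bdd_below_eps[OF x(1)], of u \<epsilon>] x(2) \<open>0 < \<epsilon>\<close>
      unfolding boundary_defect_def by auto
    then obtain \<epsilon>' where "chain_cost \<Omega> u x z \<epsilon>'" "\<epsilon>' < \<epsilon>"
      using cInf_lessD[of "Collect (chain_cost \<Omega> u x z)" \<epsilon>]
        chain_cost_direct[OF x(1) frontier_subset_closure[OF z(1)]]
      unfolding eps_eq_Inf_chain_cost by auto
    then show ?thesis
      using chain_cost_convex_combination[where \<Omega> = \<Omega> and x = x and \<epsilon> = \<epsilon>', OF l v w u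
          frontier(2)[OF z(1)]] by simp
  qed
  then have "min l (1 - l) * \<bar>v x - w x\<bar> \<le> 0" by (rule field_le_epsilon)
  then show ?thesis using l by (simp add: mult_le_0_iff min_def split: if_splits)
qed

theorem theorem4p1:
  fixes \<Omega> :: "'a::euclidean_space set" and u :: "'a \<Rightarrow> real"
  assumes "open \<Omega>" and "connected \<Omega>" and "\<Omega> \<noteq> {}" and "bounded \<Omega>"
    and "u \<in> B_J \<Omega>"
  shows "extreme_point_ae \<Omega> (B_J \<Omega>) u \<longleftrightarrow>
    (AE x in lebesgue_on \<Omega>. (INF z\<in>frontier \<Omega>. eps \<Omega> (cont_rep \<Omega> u) x z) = 0)"
proof -
  define U where "U = cont_rep \<Omega> u"
  define g where "g = boundary_defect \<Omega> U"
  note rep = B_J_cont_rep[OF \<open>open \<Omega>\<close> \<open>bounded \<Omega>\<close>]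
  note lip = B_J_lipschitz[OF \<open>open \<Omega>\<close> \<open>bounded \<Omega>\<close>]
  have frontier: "frontier \<Omega> \<noteq> {}"
    using assms(3,4) not_bounded_UNIV by (auto simp: frontier_eq_empty)
  have in_\<Omega>: "AE x in lebesgue_on \<Omega>. x \<in> \<Omega>" by (rule AE_I2) simp
  have U_eq: "AE x in lebesgue_on \<Omega>. U x = u x"
    using rep(1)[OF assms(5)] by (simp add: U_def is_cont_rep_def ae_eq_def)
  have "extreme_point_ae \<Omega> (B_J \<Omega>) u \<longleftrightarrow> (AE x in lebesgue_on \<Omega>. g x = 0)"
  proof
    assume extreme: "extreme_point_ae \<Omega> (B_J \<Omega>) u"
    \<comment> \<open>The parameter treats U + g and U - g together. On the frontier U and g both
      vanish, so the extension by zero stays Lipschitz.\<close>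
    define V where "V s x = (if x \<in> \<Omega> then U x + s * g x else 0)" for s x
    have "V s \<in> B_J \<Omega>" if "\<bar>s\<bar> \<le> 1" for s
    proof -
      have "\<bar>(U x + s * g x) - (U y + s * g y)\<bar> \<le> norm (x - y)"
        if "x \<in> closure \<Omega>" "y \<in> closure \<Omega>" for x y
      proof -
        have "\<bar>s * (g x - g y)\<bar> \<le> \<bar>g x - g y\<bar>"
          using \<open>\<bar>s\<bar> \<le> 1\<close> by (simp add: abs_mult mult_left_le_one_le)
        also have "\<dots> \<le> norm (x - y) - \<bar>U x - U y\<bar>"
          unfolding g_def U_def using that lip[OF assms(5)]
          by (intro boundary_defect_diff frontier)
        finally have "\<bar>s * (g x - g y)\<bar> + \<bar>U x - U y\<bar> \<le> norm (x - y)" by simp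
        moreover have "(U x + s * g x) - (U y + s * g y) = s * (g x - g y) + (U x - U y)"
          by (simp add: algebra_simps)
        ultimately show ?thesis using abs_triangle_ineq order_trans by metis
      qed
      moreover have "U x + s * g x = 0" if "x \<in> frontier \<Omega>" for x
        using rep(2)[OF assms(5) that] boundary_defect_frontier[OF that]
        by (simp add: U_def g_def)
      ultimately have "zero_extended_lipschitz \<Omega> (V s)"
        unfolding V_def[abs_def] by (intro zero_extended_lipschitzI assms)
      then show ?thesis by (rule zero_extended_lipschitz.in_B_J)
    qed
    then have "V 1 \<in> B_J \<Omega>" "V (- 1) \<in> B_J \<Omega>" by auto
    moreover have "ae_eq \<Omega> u (\<lambda>x. 1 / 2 * V 1 x + (1 - 1 / 2) * V (- 1) x)"
      unfolding ae_eq_def using U_eq in_\<Omega> by eventually_elim (simp add: V_def field_simps)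
    moreover have "0 < (1/2::real)" "(1/2::real) < 1" by simp_all
    \<comment> \<open>Extremality forbids the two ends of a midpoint representation of u to differ,
      and they differ by 2 g on Omega.\<close>
    ultimately have "ae_eq \<Omega> (V 1) (V (- 1))"
      using extreme unfolding extreme_point_ae_def
      by blast
    then show "AE x in lebesgue_on \<Omega>. g x = 0"
      unfolding ae_eq_def using in_\<Omega> by eventually_elim (simp add: V_def)
  next
    assume g: "AE x in lebesgue_on \<Omega>. g x = 0"
    have "ae_eq \<Omega> v w"
      if vw: "v \<in> B_J \<Omega>" "w \<in> B_J \<Omega>" and l: "0 < l" "l < 1"
        and u: "ae_eq \<Omega> u (\<lambda>x. l * v x + (1 - l) * w x)" for v w l
    proof -
      define V where "V = cont_rep \<Omega> v"
      define W where "W = cont_rep \<Omega> w"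
      have VW: "is_cont_rep \<Omega> v V" "is_cont_rep \<Omega> w W"
        using rep(1)[OF vw(1)] rep(1)[OF vw(2)] by (simp_all add: V_def W_def)
      then have AE_VW: "AE x in lebesgue_on \<Omega>. V x = v x" "AE x in lebesgue_on \<Omega>. W x = w x"
        by (simp_all add: is_cont_rep_def ae_eq_def)
      have "AE x in lebesgue_on \<Omega>. l * V x + (1 - l) * W x = u x"
        using u[unfolded ae_eq_def] AE_VW by eventually_elim simp
      \<comment> \<open>By uniqueness of continuous representatives, the decomposition of u now
        holds at every point of the closure, so it can be used along any chain.\<close>
      then have "is_cont_rep \<Omega> u (\<lambda>x. l * V x + (1 - l) * W x)"
        using VW by (auto simp: is_cont_rep_def ae_eq_def intro!: continuous_intros)
      then have U: "U x = l * V x + (1 - l) * W x" if "x \<in> closure \<Omega>" for x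
        unfolding U_def using cont_rep_unique[OF \<open>open \<Omega>\<close> rep(1)[OF assms(5)] _ that] by simp
      have eq: "V x = W x" if "x \<in> \<Omega>" "g x = 0" for x
      proof (rule boundary_defect_0_convex_combination[OF l _ _ U frontier])
        show "x \<in> closure \<Omega>" using that(1) closure_subset by blast
      qed (use lip[OF vw(1)] lip[OF vw(2)] rep(2)[OF vw(1)] rep(2)[OF vw(2)] that(2)
            in \<open>auto simp: V_def W_def g_def\<close>)
      show ?thesis
        unfolding ae_eq_def using g in_\<Omega> AE_VW by eventually_elim (metis eq)
    qed
    then show "extreme_point_ae \<Omega> (B_J \<Omega>) u"
      unfolding extreme_point_ae_def using assms(5) by blast
  qed
  then show ?thesis by (simp add: g_def U_def boundary_defect_def)
qed

end
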